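(* Let $\Phi(t)=t^r(1+\log^+t)^\delta$ with $r\ge1$ and $\delta\ge0$. Let $0<\gamma<n/r$, $r<p<n/\gamma$ and $1/q=1/p-\gamma/n$. If $u\in A_1$ and $v^{q(1/p+1/r')}\in A_\infty$ (weights on $\mathbb{R}^n$, $v>0$ a.e.), then there exists a constant $C>0$ such that for every measurable $f$ with $fv\in L^\Phi_{loc}$ and every $t>0$, $$\left[uv^{q(1/p+1/r')}\left(\left\{x\in\mathbb{R}^n:\frac{M_{\gamma,\Phi}(fv)(x)}{M_\eta v(x)}>t\right\}\right)\right]^{1/q}\le C\left[\int_{\mathbb{R}^n}\left(\frac{|f(x)|}{t}\right)^p u(x)^{p/q}\,v(x)^{1+p/r'}\,dx\right]^{1/p},$$ where $\eta(t)=t^{q/p+q/r'}(1+\log^+t)^{n\delta/(n-r\gamma)}$.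
   Context: $n$ is the dimension of $\mathbb{R}^n$; $\log^+t=\max\{0,\log t\}$ (with $\Phi(0)=\eta(0)=0$); $r'$ is the conjugate exponent, $1/r+1/r'=1$ (so $1/r'=0$ if $r=1$). Cubes $Q\subset\mathbb{R}^n$ have sides parallel to the coordinate axes. A weight is a locally integrable function that is positive and finite almost everywhere. For a nonnegative function $w$ and a measurable set $E$, $w(E)=\int_E w$; thus $uv^{s}(E)=\int_E u(x)v(x)^{s}\,dx$. A weight $w$ is in $A_1$ if there is $C>0$ with $\frac1{|Q|}\int_Q w\le C\,\mathrm{ess\,inf}_Q w$ for every cube $Q$. For $1<s<\infty$, $w\in A_s$ if $\left(\frac1{|Q|}\int_Q w\right)\left(\frac1{|Q|}\int_Q w^{1-s'}\right)^{s-1}\le C$ for every cube $Q$, where $1/s+1/s'=1$. $A_\infty=\bigcup_{s\ge1}A_s$. A Young function is a function $\varphi:[0,\infty)\to[0,\infty]$ that is convex, increasing, with $\varphi(0)=0$ and $\varphi(t)\to\infty$ as $t\to\infty$. $L^\varphi_{loc}$ is the set of measurable $f$ such that $\varphi(|f|)$ is locally integrable. The Luxemburg average is $\|f\|_{\varphi,Q}=\inf\left\{\lambda>0:\frac1{|Q|}\int_Q\varphi\left(\frac{|f(y)|}{\lambda}\right)dy\le1\right\}$. The maximal operators are $M_\varphi f(x)=\sup_{Q\ni x}\|f\|_{\varphi,Q}$ and, for $0<\gamma<n$, $M_{\gamma,\varphi}f(x)=\sup_{Q\ni x}|Q|^{\gamma/n}\|f\|_{\varphi,Q}$, the suprema being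 over all cubes containing $x$. A condition $M_{\gamma,\Phi}(fv)(x)/M_\eta v(x)>t$ is read as $M_{\gamma,\Phi}(fv)(x)>t\,M_\eta v(x)$ where $M_\eta v(x)=\infty$. *)

theory Defs
  imports "HOL-Analysis.Analysis"
begin

definition cubes :: "(real ^ 'n) set set" where
  "cubes = {cbox a (a + vec l) | a l. 0 < l}"

definition average :: "(real ^ 'n) set \<Rightarrow> (real ^ 'n \<Rightarrow> ennreal) \<Rightarrow> ennreal" where
  "average Q g = (\<integral>\<^sup>+x\<in>Q. g x \<partial>lebesgue) / emeasure lebesgue Q"

text \<open>Real powers of extended nonnegative numbers; only used with positive exponents.\<close>
definition epowr :: "ennreal \<Rightarrow> real \<Rightarrow> ennreal" where
  "epowr x a = (if x = \<infinity> then \<infinity> else ennreal (enn2real x powr a))"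

text \<open>For \<open>s = 1\<close> this is \<open>1 / 0 = 0\<close>, so that \<open>1 / conj_exponent 1 = 0\<close>, as it should be.\<close>
definition conj_exponent :: "real \<Rightarrow> real" where
  "conj_exponent s = s / (s - 1)"

lemma conj_exponent_sum: "1 \<le> s \<Longrightarrow> 1 / s + 1 / conj_exponent s = 1"
  by (cases "s = 1") (auto simp: conj_exponent_def field_simps)

definition locally_integrable :: "(real ^ 'n \<Rightarrow> real) \<Rightarrow> bool" where
  "locally_integrable w \<longleftrightarrow> (\<forall>K. compact K \<longrightarrow> set_integrable lebesgue K w)"

text \<open>Weights are real-valued here: finiteness almost everywhere allows any value on the
  remaining null set, and nothing below depends on the values on a null set.\<close>
definition weight :: "(real ^ 'n \<Rightarrow> real) \<Rightarrow> bool" where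
  "weight w \<longleftrightarrow> locally_integrable w \<and> (AE x in lebesgue. 0 < w x)"

definition essential_inf :: "(real ^ 'n) set \<Rightarrow> (real ^ 'n \<Rightarrow> real) \<Rightarrow> ennreal" where
  "essential_inf Q w = Sup {c. AE x in lebesgue. x \<in> Q \<longrightarrow> c \<le> ennreal (w x)}"

definition A_one :: "(real ^ 'n \<Rightarrow> real) set" where
  "A_one = {w. weight w \<and>
     (\<exists>C>0. \<forall>Q\<in>cubes. average Q (\<lambda>x. ennreal (w x)) \<le> ennreal C * essential_inf Q w)}"

text \<open>The Muckenhoupt class for an exponent \<open>s > 1\<close>.\<close>
definition A_class :: "real \<Rightarrow> (real ^ 'n \<Rightarrow> real) set" where
  "A_class s = {w. weight w \<and>
     (\<exists>C>0. \<forall>Q\<in>cubes. average Q (\<lambda>x. ennreal (w x)) *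
        epowr (average Q (\<lambda>x. ennreal (w x powr (1 - conj_exponent s)))) (s - 1) \<le> ennreal C)}"

definition A_infinity :: "(real ^ 'n \<Rightarrow> real) set" where
  "A_infinity = A_one \<union> (\<Union>s\<in>{1<..}. A_class s)"

definition L_loc :: "(real \<Rightarrow> ennreal) \<Rightarrow> (real ^ 'n \<Rightarrow> real) set" where
  "L_loc \<phi> = {f \<in> borel_measurable lebesgue.
     \<forall>K. compact K \<longrightarrow> (\<integral>\<^sup>+x\<in>K. \<phi> \<bar>f x\<bar> \<partial>lebesgue) < \<infinity>}"

text \<open>The value is \<open>\<infinity>\<close> if no \<open>c\<close> is admissible.\<close>
definition luxemburg :: "(real \<Rightarrow> ennreal) \<Rightarrow> (real ^ 'n) set \<Rightarrow> (real ^ 'n \<Rightarrow> real) \<Rightarrow> ennreal" where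
  "luxemburg \<phi> Q f = Inf {ennreal c | c. 0 < c \<and> average Q (\<lambda>y. \<phi> (\<bar>f y\<bar> / c)) \<le> 1}"

definition maximal :: "(real \<Rightarrow> ennreal) \<Rightarrow> (real ^ 'n \<Rightarrow> real) \<Rightarrow> real ^ 'n \<Rightarrow> ennreal" where
  "maximal \<phi> f x = (SUP Q\<in>{Q \<in> cubes. x \<in> Q}. luxemburg \<phi> Q f)"

definition frac_maximal ::
    "real \<Rightarrow> (real \<Rightarrow> ennreal) \<Rightarrow> (real ^ 'n \<Rightarrow> real) \<Rightarrow> real ^ 'n \<Rightarrow> ennreal" where
  "frac_maximal \<gamma> \<phi> f x = (SUP Q\<in>{Q \<in> cubes. x \<in> Q}.
     ennreal (measure lebesgue Q powr (\<gamma> / real CARD('n))) * luxemburg \<phi> Q f)"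

definition power_log :: "real \<Rightarrow> real \<Rightarrow> real \<Rightarrow> ennreal" where
  "power_log a b t = ennreal (t powr a * (1 + max 0 (ln t)) powr b)"

lemma power_log_0: "power_log a b 0 = 0"
  by (simp add: power_log_def)

text \<open>In \<open>ennreal\<close> a quotient with denominator \<open>\<infinity>\<close> is \<open>0\<close>. Hence a point where \<open>maximal \<eta> v\<close>
  is \<open>\<infinity>\<close> is not in the set, in accordance with the reading
  \<open>frac_maximal \<gamma> \<phi> g x > t * maximal \<eta> v x\<close>, which fails there.\<close>
definition quotient_level_set ::
    "real \<Rightarrow> (real \<Rightarrow> ennreal) \<Rightarrow> (real \<Rightarrow> ennreal) \<Rightarrow> (real ^ 'n \<Rightarrow> real) \<Rightarrow> (real ^ 'n \<Rightarrow> real) \<Rightarrow>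
     real \<Rightarrow> (real ^ 'n) set" where
  "quotient_level_set \<gamma> \<phi> \<eta> g v t = {x. frac_maximal \<gamma> \<phi> g x / maximal \<eta> v x > ennreal t}"

end

theory Submission
  imports Defs
begin

text \<open>Write \<open>w = v\<^sup>s\<close>, \<open>d\<mu> = u dx\<close>, and let \<open>h\<close> be the integrand on the right, \<open>H = \<integral> h\<close>. The level set is
  controlled by one pointwise inequality: at almost every \<open>x\<close> in it,
  \<open>w(x) \<le> C H\<^bsup>q/p - 1\<^esup> S(x)\<close> with a function \<open>S\<close> such that \<open>\<integral> S d\<mu> \<le> C H\<close>. Integrating this
  against \<open>u\<close> over the level set gives \<open>C H\<^bsup>q/p\<^esup>\<close>, which is the assertion.

  The pointwise inequality comes from the strict inequality \<open>r < p\<close>, which leaves room in a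
  Hoelder inequality. Write \<open>h = k u\<close>. On a cube \<open>Q\<close>, a power \<open>\<sigma>\<close> slightly larger than \<open>r\<close> absorbs
  the logarithm in \<open>\<Phi>\<close> (\<open>luxemburg_le_power_average\<close>), and \<open>(|f| v / t)\<^sup>\<sigma>\<close> factors as
  \<open>(k\<^sup>b u)\<^sup>\<theta> w\<^bsup>1 - \<theta>\<^esup>\<close> times a negative power of \<open>u\<close>. As \<open>s > 1\<close>, the exponents can be chosen with
  \<open>b < 1\<close> (\<open>hoelder_exponents_exist\<close>). The condition \<open>A\<^sub>1\<close> bounds \<open>u\<close> from below on \<open>Q\<close> by its average,
  so the negative power is harmless, and
  \<open>|Q|\<^bsup>\<gamma>/n\<^esup> \<parallel>f v\<parallel>\<^bsub>\<Phi>,Q\<^esub> \<le> C t \<mu>(Q)\<^bsup>\<gamma>/n\<^esup> N\<^bsup>1/(pb)\<^esup> W\<^bsup>1/s - 1/q\<^esup>\<close>,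
  where \<open>N\<close> is the \<open>\<mu>\<close>-average of \<open>k\<^sup>b\<close> and \<open>W\<close> the average of \<open>w\<close> over \<open>Q\<close> (\<open>fractional_term_le\<close>).

  Let \<open>m\<close> be the value of the maximal function of \<open>v\<close> at \<open>x\<close>. Since \<open>\<eta>(\<tau>) \<ge> \<tau>\<^sup>s\<close>, every cube containing
  \<open>x\<close> has \<open>W \<le> m\<^sup>s\<close>. If \<open>x\<close> is in the level set, some \<open>Q\<close> has \<open>t m\<close> below the displayed bound; the power of \<open>m\<close>
  moves to the left and leaves \<open>m\<^sup>s \<le> C \<mu>(Q)\<^bsup>q/p - 1\<^esup> N\<^bsup>q/(pb)\<^esup>\<close>. By Jensen \<open>N\<^bsup>1/b\<^esup> \<le> H / \<mu>(Q)\<close>, and Hedberg's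
  device of using this for the excess power \<open>q/p - 1\<close> of \<open>N\<^bsup>1/b\<^esup>\<close> leaves
  \<open>m\<^sup>s \<le> C H\<^bsup>q/p - 1\<^esup> N\<^bsup>1/b\<^esup>\<close> (\<open>power_of_height_le\<close>).

  Two facts close the argument. First, \<open>w\<close> is almost everywhere at most the supremum of its averages, hence at most \<open>m\<^sup>s\<close>
  (\<open>AE_le_maximal\<close>). This deals with the product \<open>u w\<close>, which need not be locally
  integrable: on the level set it is replaced by \<open>C H\<^bsup>q/p - 1\<^esup> u S\<close>, which is integrable. Second, \<open>A\<^sub>1\<close> makes \<open>\<mu>\<close> a doubling measure, so its maximal operator is
  bounded on \<open>L\<^bsup>1/b\<^esup>(\<mu>)\<close>; applied to \<open>k\<^sup>b\<close> this is \<open>\<integral> S d\<mu> \<le> C \<integral> k d\<mu> = C H\<close>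
  (\<open>strong_type_maximal\<close>).\<close>

section \<open>Powers, layer cakes and the Hoelder inequality\<close>

lemma epowr_ennreal: "0 \<le> x \<Longrightarrow> epowr (ennreal x) a = ennreal (x powr a)"
  by (simp add: epowr_def)

lemma epowr_mono: "0 \<le> a \<Longrightarrow> x \<le> y \<Longrightarrow> epowr x a \<le> epowr y a"
  by (cases x; cases y) (auto simp: epowr_ennreal epowr_def ennreal_leI powr_mono2 top_unique)

lemma epowr_ennreal_mult:
  assumes "0 < c"
  shows "epowr (ennreal c * x) a = ennreal (c powr a) * epowr x a"
proof (cases x)
  case (real y)
  then show ?thesis using assms by (simp add: epowr_ennreal ennreal_mult[symmetric] powr_mult)
next
  case top
  then show ?thesis using assms by (simp add: epowr_def ennreal_mult_top)
qed

lemma less_epowr_imp: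
  assumes "ennreal \<tau> < epowr x P" "0 \<le> \<tau>" "0 < P"
  shows "ennreal (\<tau> powr (1 / P)) < x"
proof (cases x)
  case (real y)
  then have "\<tau> < y powr P" using assms by (simp add: epowr_ennreal ennreal_less_iff)
  then have "\<tau> powr (1 / P) < (y powr P) powr (1 / P)" using assms by (intro powr_less_mono2) auto
  also have "\<dots> = y" using assms real by (simp add: powr_powr)
  finally show ?thesis using real assms by (simp add: ennreal_less_iff)
qed auto

text \<open>A quotient of extended numbers exceeds \<open>x\<close> only if its denominator is finite; for
  denominator \<open>0\<close> the numerator is then positive, so that the product form of the inequality is correct there too.\<close>

lemma mult_less_if_less_divide_ennreal:
  fixes x y z :: ennreal
  assumes "x < y / z"
  shows "z \<noteq> \<infinity>" "x * z < y"
proof -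
  show "z \<noteq> \<infinity>" using assms by auto
  show "x * z < y"
  proof (rule ccontr)
    assume "\<not> x * z < y"
    then have le: "y \<le> x * z" by simp
    show False
    proof (cases "z = 0")
      case True
      then show ?thesis using le assms by auto
    next
      case False
      then have "y / z \<le> x" using le by (intro divide_le_posI_ennreal) (auto simp: zero_less_iff_neq_zero mult.commute)
      with assms show False by simp
    qed
  qed
qed

lemma le_ennreal_by_right_limit:
  fixes h :: "real \<Rightarrow> real"
  assumes le: "\<And>y. x < y \<Longrightarrow> a \<le> ennreal (h y)" and h: "(h \<longlongrightarrow> h x) (at_right x)"
  shows "a \<le> ennreal (h x)"
proof (rule tendsto_lowerbound)
  show "((\<lambda>y. ennreal (h y)) \<longlongrightarrow> ennreal (h x)) (at_right x)" using h by (rule tendsto_ennrealI)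
  show "\<forall>\<^sub>F y in at_right x. a \<le> ennreal (h y)"
    using eventually_at_right_less[of x] by eventually_elim (rule le)
qed simp

lemma nn_integral_powr_initial:
  fixes b c :: real
  assumes "b < 1" "0 \<le> c"
  shows "(\<integral>\<^sup>+\<tau>. ennreal (\<tau> powr (-b)) * indicator {0..c} \<tau> \<partial>lborel) = ennreal (c powr (1 - b) / (1 - b))"
  using has_integral_powr_from_0[of "-b" c] assms
  by (intro nn_integral_has_integral_lebesgue') (auto simp: algebra_simps)

lemma nn_integral_layer_cake:
  fixes S :: "'a \<Rightarrow> ennreal"
  assumes "sigma_finite_measure M" and [measurable]: "S \<in> borel_measurable M"
  shows "(\<integral>\<^sup>+x. S x \<partial>M) = (\<integral>\<^sup>+\<tau>. indicator {0..} \<tau> * emeasure M {x \<in> space M. ennreal \<tau> < S x} \<partial>lborel)"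
proof -
  interpret sigma_finite_measure M by fact
  interpret P: pair_sigma_finite lborel M ..
  have S: "S x = (\<integral>\<^sup>+\<tau>. indicator {\<tau>. 0 \<le> \<tau> \<and> ennreal \<tau> < S x} \<tau> \<partial>lborel)" for x
  proof (cases "S x")
    case (real y)
    then have "{\<tau>. 0 \<le> \<tau> \<and> ennreal \<tau> < S x} = {0..<y}" by (auto simp: ennreal_less_iff)
    then show ?thesis using real by simp
  next
    case top
    then have "{\<tau>. 0 \<le> \<tau> \<and> ennreal \<tau> < S x} = {0..}" by auto
    moreover have "ennreal (real N) \<le> emeasure lborel {0::real..}" for N :: nat
      using emeasure_mono[of "{0..real N}" "{0..}" lborel] by simp
    then have "emeasure lborel {0::real..} = \<infinity>"
      by (metis ennreal_Ex_less_of_nat ennreal_of_nat_eq_real_of_nat infinity_ennreal_def leD top.not_eq_extremum)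
    ultimately show ?thesis using top by simp
  qed
  have "(\<integral>\<^sup>+x. S x \<partial>M) = (\<integral>\<^sup>+x. (\<integral>\<^sup>+\<tau>. indicator {0..} \<tau> * indicator {x \<in> space M. ennreal \<tau> < S x} x \<partial>lborel) \<partial>M)"
    by (subst S, intro nn_integral_cong) (auto split: split_indicator)
  also have "\<dots> = (\<integral>\<^sup>+\<tau>. (\<integral>\<^sup>+x. indicator {0..} \<tau> * indicator {x \<in> space M. ennreal \<tau> < S x} x \<partial>M) \<partial>lborel)"
    by (rule P.Fubini') measurable
  also have "\<dots> = (\<integral>\<^sup>+\<tau>. indicator {0..} \<tau> * emeasure M {x \<in> space M. ennreal \<tau> < S x} \<partial>lborel)"
    by (intro nn_integral_cong) (simp add: nn_integral_cmult)
  finally show ?thesis .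
qed

text \<open>Hoelder's inequality with exponents \<open>1/\<theta>\<close> and \<open>1/(1 - \<theta>)\<close>, in terms of upper bounds \<open>F\<close> and \<open>G\<close> for the
  two integrals: Young's inequality for \<open>f/F\<close> and \<open>g/G\<close>, integrated.\<close>

lemma nn_integral_powr_product_le:
  fixes f g :: "'a \<Rightarrow> real"
  assumes [measurable]: "f \<in> borel_measurable M" "g \<in> borel_measurable M"
    and nonneg: "\<And>x. 0 \<le> f x" "\<And>x. 0 \<le> g x" and \<theta>: "0 < \<theta>" "\<theta> < 1"
    and F: "(\<integral>\<^sup>+x. ennreal (f x) \<partial>M) \<le> ennreal F" "0 \<le> F"
    and G: "(\<integral>\<^sup>+x. ennreal (g x) \<partial>M) \<le> ennreal G" "0 \<le> G"
  shows "(\<integral>\<^sup>+x. ennreal (f x powr \<theta> * g x powr (1 - \<theta>)) \<partial>M) \<le> ennreal (F powr \<theta> * G powr (1 - \<theta>))"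
proof -
  consider "F = 0" | "G = 0" | "0 < F" "0 < G" using F(2) G(2) by (metis less_eq_real_def)
  then show ?thesis
  proof cases
    case 1
    then have "AE x in M. ennreal (f x) = 0" using F(1) by (subst nn_integral_0_iff_AE[symmetric]) auto
    then have "AE x in M. ennreal (f x powr \<theta> * g x powr (1 - \<theta>)) = 0"
    proof eventually_elim
      case (elim x)
      then have "f x = 0" using nonneg[of x] by (simp add: ennreal_eq_0_iff)
      then show ?case by simp
    qed
    then have "(\<integral>\<^sup>+x. ennreal (f x powr \<theta> * g x powr (1 - \<theta>)) \<partial>M) = 0"
      by (subst nn_integral_0_iff_AE) auto
    then show ?thesis by simp
  next
    case 2
    then have "AE x in M. ennreal (g x) = 0" using G(1) by (subst nn_integral_0_iff_AE[symmetric]) auto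
    then have "AE x in M. ennreal (f x powr \<theta> * g x powr (1 - \<theta>)) = 0"
    proof eventually_elim
      case (elim x)
      then have "g x = 0" using nonneg[of x] by (simp add: ennreal_eq_0_iff)
      then show ?case by simp
    qed
    then have "(\<integral>\<^sup>+x. ennreal (f x powr \<theta> * g x powr (1 - \<theta>)) \<partial>M) = 0"
      by (subst nn_integral_0_iff_AE) auto
    then show ?thesis by simp
  next
    case 3
    let ?c = "F powr \<theta> * G powr (1 - \<theta>)"
    have pw: "f x powr \<theta> * g x powr (1 - \<theta>) \<le> ?c * (\<theta> / F) * f x + ?c * ((1 - \<theta>) / G) * g x" for x
    proof (cases "f x = 0 \<or> g x = 0")
      case True
      then show ?thesis using nonneg[of x] 3 \<theta> by auto
    next
      case False
      then have "0 < f x" "0 < g x" using nonneg[of x] by auto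
      then have "(f x / F) powr \<theta> * (g x / G) powr (1 - \<theta>) \<le> \<theta> * (f x / F) + (1 - \<theta>) * (g x / G)"
        using 3 \<theta> by (intro Youngs_inequality_0) auto
      then have "?c * ((f x / F) powr \<theta> * (g x / G) powr (1 - \<theta>)) \<le> ?c * (\<theta> * (f x / F) + (1 - \<theta>) * (g x / G))"
        by (intro mult_left_mono) auto
      moreover have "?c * ((f x / F) powr \<theta> * (g x / G) powr (1 - \<theta>)) = f x powr \<theta> * g x powr (1 - \<theta>)"
        using 3 nonneg[of x] by (simp add: powr_divide)
      ultimately show ?thesis by (simp add: algebra_simps)
    qed
    define c1 where "c1 = ?c * (\<theta> / F)"
    define c2 where "c2 = ?c * ((1 - \<theta>) / G)"
    have c: "0 \<le> c1" "0 \<le> c2" using 3 \<theta> by (auto simp: c1_def c2_def)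
    have "(\<integral>\<^sup>+x. ennreal (f x powr \<theta> * g x powr (1 - \<theta>)) \<partial>M)
      \<le> (\<integral>\<^sup>+x. ennreal c1 * ennreal (f x) + ennreal c2 * ennreal (g x) \<partial>M)"
    proof (rule nn_integral_mono)
      fix x
      have "ennreal (f x powr \<theta> * g x powr (1 - \<theta>)) \<le> ennreal (c1 * f x + c2 * g x)"
        using pw by (intro ennreal_leI) (simp add: c1_def c2_def)
      also have "\<dots> = ennreal c1 * ennreal (f x) + ennreal c2 * ennreal (g x)"
        using c nonneg[of x] by (simp add: ennreal_mult)
      finally show "ennreal (f x powr \<theta> * g x powr (1 - \<theta>))
        \<le> ennreal c1 * ennreal (f x) + ennreal c2 * ennreal (g x)" .
    qed
    also have "\<dots> = ennreal c1 * (\<integral>\<^sup>+x. ennreal (f x) \<partial>M) + ennreal c2 * (\<integral>\<^sup>+x. ennreal (g x) \<partial>M)"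
      by (simp add: nn_integral_add nn_integral_cmult)
    also have "\<dots> \<le> ennreal c1 * ennreal F + ennreal c2 * ennreal G"
      using F(1) G(1) by (intro add_mono mult_left_mono) auto
    also have "\<dots> = ennreal (c1 * F + c2 * G)"
      using c 3 by (simp add: ennreal_plus[symmetric] ennreal_mult[symmetric] del: ennreal_plus)
    also have "c1 * F + c2 * G = ?c"
      using 3 unfolding c1_def c2_def by (simp add: distrib_left[symmetric])
    finally show ?thesis .
  qed
qed

section \<open>Cubes and averages\<close>

lemma emeasure_cube:
  fixes a :: "real ^ 'n"
  assumes "0 \<le> l"
  shows "emeasure lebesgue (cbox a (a + vec l)) = ennreal (l ^ CARD('n))"
proof -
  have "measure lebesgue (cbox a (a + vec l)) = l ^ CARD('n)"
    using assms by (simp add: measure_completion content_cbox_if_cart interval_eq_empty_cart not_less)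
  then show ?thesis
    using emeasure_eq_measure2[OF lmeasurable_cbox] by metis
qed

lemma cube_sets [measurable]: "Q \<in> cubes \<Longrightarrow> Q \<in> sets lebesgue"
  by (auto simp: cubes_def)

lemma cubesE:
  assumes "Q \<in> cubes"
  obtains a l where "0 < l" "Q = cbox a (a + vec l)"
  using assms by (auto simp: cubes_def)

lemma cubesI: "0 < l \<Longrightarrow> cbox a (a + vec l) \<in> cubes"
  by (auto simp: cubes_def)

lemma cube_emeasure_pos_finite:
  assumes "Q \<in> (cubes :: (real ^ 'n) set set)"
  shows "0 < emeasure lebesgue Q" "emeasure lebesgue Q < \<infinity>" "0 < measure lebesgue Q"
    "emeasure lebesgue Q = ennreal (measure lebesgue Q)"
proof -
  obtain a l where l: "0 < l" and Q: "Q = cbox a (a + vec l)" using assms by (rule cubesE)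
  have e: "emeasure lebesgue Q = ennreal (l ^ CARD('n))" unfolding Q using l by (intro emeasure_cube) auto
  then show "0 < emeasure lebesgue Q" "emeasure lebesgue Q < \<infinity>" using l by auto
  have "measure lebesgue Q = l ^ CARD('n)" using e l by (simp add: measure_def)
  then show "0 < measure lebesgue Q" "emeasure lebesgue Q = ennreal (measure lebesgue Q)" using l e by auto
qed

lemma cube_subset_cball:
  fixes a :: "real ^ 'n"
  assumes "0 \<le> l"
  shows "cbox a (a + vec l) \<subseteq> cball (a + vec (l / 2)) (l * CARD('n))"
proof
  fix x assume x: "x \<in> cbox a (a + vec l)"
  have "norm (x - (a + vec (l / 2))) \<le> (\<Sum>i\<in>UNIV. \<bar>(x - (a + vec (l / 2))) $ i\<bar>)"
    by (rule norm_le_l1_cart)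
  also have "\<dots> \<le> (\<Sum>i\<in>(UNIV::'n set). l)"
  proof (rule sum_mono)
    fix i :: 'n
    have "a $ i \<le> x $ i \<and> x $ i \<le> a $ i + l" using x by (auto simp: mem_box_cart)
    then show "\<bar>(x - (a + vec (l / 2))) $ i\<bar> \<le> l" using assms by (simp add: abs_le_iff field_simps)
  qed
  finally show "x \<in> cball (a + vec (l / 2)) (l * CARD('n))"
    by (simp add: dist_norm norm_minus_commute mult.commute)
qed

lemma cball_subset_cube:
  fixes c :: "real ^ 'n"
  shows "cball c \<rho> \<subseteq> cbox (c - vec \<rho>) (c - vec \<rho> + vec (2 * \<rho>))"
proof
  fix x assume "x \<in> cball c \<rho>"
  then have "norm (x - c) \<le> \<rho>" by (simp add: dist_norm norm_minus_commute)
  then have "\<bar>x $ i - c $ i\<bar> \<le> \<rho>" for i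
    using component_le_norm_cart[of "x - c" i] by simp
  then show "x \<in> cbox (c - vec \<rho>) (c - vec \<rho> + vec (2 * \<rho>))"
    by (simp add: mem_box_cart abs_le_iff algebra_simps)
qed

text \<open>A countable family that stands in for all cubes. A supremum over it is measurable as a
  countable supremum, while for the supremum over all cubes containing a point this would need a separate argument.\<close>

lemma countable_cube_family:
  obtains \<R> :: "(real ^ 'n) set set" where "countable \<R>" "\<R> \<subseteq> cubes"
    "\<And>a l. 0 < l \<Longrightarrow> \<exists>b m. cbox b (b + vec m) \<in> \<R> \<and> cbox a (a + vec l) \<subseteq> cbox b (b + vec m) \<and> m \<le> 2 * l"
proof -
  obtain D :: "(real ^ 'n) set" where D: "countable D" "\<And>X. open X \<Longrightarrow> X \<noteq> {} \<Longrightarrow> \<exists>d\<in>D. d \<in> X"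
    using countable_dense_setE by metis
  define \<R> where "\<R> = (\<lambda>(b, m). cbox b (b + vec m)) ` (D \<times> {m \<in> \<rat>. 0 < m})"
  show thesis
  proof
    show "countable \<R>" unfolding \<R>_def using D(1) countable_rat
      by (intro countable_image countable_SIGMA) (auto intro: countable_subset[of _ \<rat>])
    show "\<R> \<subseteq> cubes" by (auto simp: \<R>_def cubes_def)
    fix a :: "real ^ 'n" and l :: real assume l: "0 < l"
    have "box (a - vec (l / 2)) a \<noteq> {}" using l by (auto simp: interval_ne_empty_cart)
    then obtain b where b: "b \<in> D" "b \<in> box (a - vec (l / 2)) a" using D(2) open_box by blast
    have "3 / 2 * l < 2 * l" using l by simp
    then obtain m where m: "m \<in> \<rat>" "3 / 2 * l < m" "m < 2 * l" using Rats_dense_in_real by blast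
    have bi: "a $ i - l / 2 < b $ i \<and> b $ i < a $ i" for i using b(2) by (auto simp: mem_box_cart)
    have "cbox a (a + vec l) \<subseteq> cbox b (b + vec m)"
      unfolding subset_interval_cart
    proof (intro impI allI)
      fix i show "b $ i \<le> a $ i \<and> (a + vec l) $ i \<le> (b + vec m) $ i"
        using bi[of i] m by simp
    qed
    moreover have "cbox b (b + vec m) \<in> \<R>" unfolding \<R>_def using b m l by force
    ultimately show "\<exists>b m. cbox b (b + vec m) \<in> \<R> \<and> cbox a (a + vec l) \<subseteq> cbox b (b + vec m) \<and> m \<le> 2 * l"
      using m by fastforce
  qed
qed

lemma nn_integral_cube_eq_average:
  assumes "Q \<in> cubes"
  shows "(\<integral>\<^sup>+x\<in>Q. g x \<partial>lebesgue) = average Q g * emeasure lebesgue Q"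
  using cube_emeasure_pos_finite[OF assms]
  by (simp add: average_def ennreal_divide_times ennreal_divide_self less_top)

lemma average_eq_uniform_measure:
  assumes Q: "Q \<in> cubes" and [measurable]: "g \<in> borel_measurable lebesgue"
  shows "average Q g = (\<integral>\<^sup>+x. g x \<partial>uniform_measure lebesgue Q)"
  unfolding average_def
  by (rule nn_integral_uniform_measure[symmetric]) (use cube_emeasure_pos_finite[OF Q] cube_sets[OF Q] in auto)

lemma emeasure_uniform_measure_cube:
  assumes "Q \<in> cubes"
  shows "emeasure (uniform_measure lebesgue Q) UNIV = 1"
proof -
  have "emeasure (uniform_measure lebesgue Q) UNIV = emeasure lebesgue Q / emeasure lebesgue Q"
    using cube_sets[OF assms] by (subst emeasure_uniform_measure) auto
  also have "\<dots> = 1"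
    using cube_emeasure_pos_finite(1,2)[OF assms] by (intro ennreal_divide_self) auto
  finally show ?thesis .
qed

lemma average_mono_AE:
  assumes "AE x in lebesgue. x \<in> Q \<longrightarrow> f x \<le> g x"
  shows "average Q f \<le> average Q g"
  unfolding average_def
  by (intro divide_right_mono_ennreal nn_integral_mono_AE eventually_mono[OF assms]) (auto split: split_indicator)

lemma average_cmult:
  assumes "Q \<in> cubes" "g \<in> borel_measurable lebesgue"
  shows "average Q (\<lambda>x. c * g x) = c * average Q g"
  using assms by (subst (1 2) average_eq_uniform_measure) (auto intro!: nn_integral_cmult)

lemma average_const_add:
  assumes "Q \<in> cubes" "g \<in> borel_measurable lebesgue"
  shows "average Q (\<lambda>x. c + g x) = c + average Q g"
  using assms by (subst (1 2) average_eq_uniform_measure) (auto simp: nn_integral_add emeasure_uniform_measure_cube simp del: emeasure_uniform_measure)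

section \<open>The maximal operator of a doubling measure\<close>

text \<open>Doubling in the form that covering arguments use. A cube of side \<open>l\<close> lies in a ball of radius
  \<open>n l\<close>, and the fivefold dilation of this ball lies in a cube of side \<open>10 n l\<close>; this explains the constant.\<close>

locale cube_growth =
  fixes M :: "(real ^ 'n) measure" and D :: real
  assumes sets_M [simp, measurable_cong]: "sets M = sets lebesgue"
    and M_sigma_finite: "sigma_finite_measure M"
    and cube_pos: "Q \<in> cubes \<Longrightarrow> 0 < emeasure M Q"
    and cube_finite: "Q \<in> cubes \<Longrightarrow> emeasure M Q < \<infinity>"
    and D_pos: "0 < D"
    and growth: "0 < (l :: real) \<Longrightarrow> cbox a (a + vec l) \<subseteq> cbox b (b + vec m) \<Longrightarrow> m \<le> 10 * real CARD('n) * l \<Longrightarrow>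
      emeasure M (cbox b (b + vec m)) \<le> ennreal D * emeasure M (cbox a (a + vec l))"

begin

text \<open>The weak type estimate without any maximal function: Vitali's lemma selects disjoint cubes from
  \<open>F\<close> whose dilations cover \<open>\<Union>F\<close>, and disjointness lets the integrals over them add up to at most the whole integral.\<close>

lemma weak_type_finite:
  assumes "finite F" "F \<subseteq> cubes" and [measurable]: "k \<in> borel_measurable M"
    and avg: "\<And>Q. Q \<in> F \<Longrightarrow> \<tau> * emeasure M Q \<le> (\<integral>\<^sup>+x\<in>Q. k x \<partial>M)"
  shows "\<tau> * emeasure M (\<Union>F) \<le> ennreal D * (\<integral>\<^sup>+x. k x \<partial>M)"
proof -
  have "\<exists>a l. 0 < l \<and> Q = cbox a (a + vec l)" if "Q \<in> F" for Q
    using that assms(2) unfolding cubes_def by blast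
  then obtain a l where al: "\<And>Q. Q \<in> F \<Longrightarrow> 0 < l Q \<and> Q = cbox (a Q) (a Q + vec (l Q))" by metis
  define c where "c Q = a Q + vec (l Q / 2)" for Q
  define \<rho> where "\<rho> Q = l Q * CARD('n)" for Q
  obtain B where B: "\<And>Q. Q \<in> F \<Longrightarrow> \<rho> Q \<le> B"
    using finite_imageI[OF assms(1), of \<rho>] by (metis Max_ge imageI)
  have \<rho>: "\<And>Q. Q \<in> F \<Longrightarrow> 0 < \<rho> Q \<and> \<rho> Q \<le> B" using al B by (auto simp: \<rho>_def)
  obtain C where C: "countable C" "C \<subseteq> F"
     "pairwise (\<lambda>i j. disjnt (cball (c i) (\<rho> i)) (cball (c j) (\<rho> j))) C"
     "\<And>i. i \<in> F \<Longrightarrow> \<exists>j. j \<in> C \<and> \<not> disjnt (cball (c i) (\<rho> i)) (cball (c j) (\<rho> j)) \<and>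
                        cball (c i) (\<rho> i) \<subseteq> ball (c j) (5 * \<rho> j)"
    by (rule Vitali_covering_lemma_cballs_balls[where K = F and r = \<rho> and B = B and a = c], erule \<rho>, rule that)
  have fC: "finite C" using C(2) assms(1) finite_subset by auto
  define E where "E Q = cbox (c Q - vec (5 * \<rho> Q)) (c Q - vec (5 * \<rho> Q) + vec (2 * (5 * \<rho> Q)))" for Q
  have QB: "Q \<subseteq> cball (c Q) (\<rho> Q)" if "Q \<in> F" for Q
    using al[OF that] cube_subset_cball[of "l Q" "a Q"] by (simp add: c_def \<rho>_def)
  have BE: "cball (c Q) (5 * \<rho> Q) \<subseteq> E Q" for Q unfolding E_def by (rule cball_subset_cube)
  have cov: "\<Union>F \<subseteq> (\<Union>Q\<in>C. E Q)"
  proof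
    fix x assume "x \<in> \<Union>F"
    then obtain Q where Q: "Q \<in> F" "x \<in> Q" by auto
    obtain j where j: "j \<in> C" "cball (c Q) (\<rho> Q) \<subseteq> ball (c j) (5 * \<rho> j)" using C(4)[OF Q(1)] by auto
    have "x \<in> E j" using Q QB j BE[of j] ball_subset_cball by blast
    with j show "x \<in> (\<Union>Q\<in>C. E Q)" by auto
  qed
  have EQ: "emeasure M (E Q) \<le> ennreal D * emeasure M Q" if "Q \<in> F" for Q
  proof -
    note q = al[OF that]
    have \<rho>: "\<rho> Q > 0" using q by (simp add: \<rho>_def)
    have "Q \<subseteq> E Q" using QB[OF that] BE[of Q] \<rho> by (auto simp: subset_iff)
    then have "cbox (a Q) (a Q + vec (l Q)) \<subseteq> E Q" using q by auto
    then have "emeasure M (E Q) \<le> ennreal D * emeasure M (cbox (a Q) (a Q + vec (l Q)))"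
      unfolding E_def by (rule growth[OF conjunct1[OF q]]) (simp add: \<rho>_def)
    with q show ?thesis by simp
  qed
  have dis: "disjoint_family_on (\<lambda>Q. Q) C"
    using C(3) C(2) QB unfolding disjoint_family_on_def pairwise_def disjnt_def by blast
  have [measurable]: "\<And>Q. Q \<in> C \<Longrightarrow> Q \<in> sets lebesgue" "\<And>Q. E Q \<in> sets lebesgue"
    using C(2) assms(2) by (auto simp: E_def)
  have "\<tau> * emeasure M (\<Union>F) \<le> \<tau> * emeasure M (\<Union>Q\<in>C. E Q)"
    using cov fC by (intro mult_left_mono emeasure_mono) auto
  also have "\<dots> \<le> \<tau> * (\<Sum>Q\<in>C. emeasure M (E Q))"
    using fC by (intro mult_left_mono emeasure_subadditive_finite) auto
  also have "\<dots> \<le> \<tau> * (\<Sum>Q\<in>C. ennreal D * emeasure M Q)"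
    using C(2) EQ by (intro mult_left_mono sum_mono) auto
  also have "\<dots> = ennreal D * (\<Sum>Q\<in>C. \<tau> * emeasure M Q)"
    by (simp add: sum_distrib_left mult_ac)
  also have "\<dots> \<le> ennreal D * (\<Sum>Q\<in>C. \<integral>\<^sup>+x\<in>Q. k x \<partial>M)"
    using C(2) avg by (intro mult_left_mono sum_mono) auto
  also have "(\<Sum>Q\<in>C. \<integral>\<^sup>+x\<in>Q. k x \<partial>M) = (\<integral>\<^sup>+x. (\<Sum>Q\<in>C. k x * indicator Q x) \<partial>M)"
    by (subst nn_integral_sum) auto
  also have "\<dots> = (\<integral>\<^sup>+x. k x * indicator (\<Union>Q\<in>C. Q) x \<partial>M)"
    unfolding sum_distrib_left[symmetric] indicator_UN_disjoint[OF fC dis] ..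
  also have "ennreal D * \<dots> \<le> ennreal D * (\<integral>\<^sup>+x. k x \<partial>M)"
    by (intro mult_left_mono nn_integral_mono) (auto split: split_indicator)
  finally show ?thesis .
qed

lemma weak_type_countable:
  assumes "countable F" "F \<subseteq> cubes" and [measurable]: "k \<in> borel_measurable M"
    and avg: "\<And>Q. Q \<in> F \<Longrightarrow> \<tau> * emeasure M Q \<le> (\<integral>\<^sup>+x\<in>Q. k x \<partial>M)"
  shows "\<tau> * emeasure M (\<Union>F) \<le> ennreal D * (\<integral>\<^sup>+x. k x \<partial>M)"
proof (cases "F = {}")
  case False
  define A where "A N = \<Union>(from_nat_into F ` {..<N})" for N :: nat
  have inF: "from_nat_into F i \<in> F" for i using False by (rule from_nat_into)
  have U: "\<Union>F = (\<Union>N. A N)"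
  proof -
    have "(\<Union>N. A N) = \<Union>(range (from_nat_into F))" unfolding A_def by blast
    then show ?thesis using range_from_nat_into[OF False assms(1)] by simp
  qed
  have A_sets: "A N \<in> sets lebesgue" for N
    unfolding A_def using inF assms(2) by (intro sets.finite_Union) (auto intro!: cube_sets)
  have "incseq A" unfolding A_def incseq_def by (auto intro!: Union_mono image_mono)
  then have "\<tau> * emeasure M (\<Union>F) = (SUP N. \<tau> * emeasure M (A N))"
    unfolding U by (subst SUP_emeasure_incseq[symmetric]) (auto simp: SUP_mult_left_ennreal A_sets)
  also have "\<dots> \<le> ennreal D * (\<integral>\<^sup>+x. k x \<partial>M)"
    unfolding A_def using inF assms(2) avg
    by (intro SUP_least weak_type_finite) auto
  finally show ?thesis .
qed auto

text \<open>Only the part of \<open>\<kappa>\<close> above \<open>\<sigma>/2\<close> matters, because the rest contributes at most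
  \<open>\<sigma>/2\<close> to every average. This truncation is what turns the weak type estimate into a strong one.\<close>

lemma emeasure_high_average:
  assumes R: "countable R" "R \<subseteq> cubes" and [measurable]: "\<kappa> \<in> borel_measurable M"
    and \<sigma>: "0 < \<sigma>"
  shows "emeasure M (\<Union>{Q \<in> R. ennreal \<sigma> < (\<integral>\<^sup>+x\<in>Q. ennreal (\<kappa> x) \<partial>M) / emeasure M Q})
    \<le> ennreal (2 * D / \<sigma>) * (\<integral>\<^sup>+x. ennreal (\<kappa> x) * indicator {x. \<sigma> / 2 < \<kappa> x} x \<partial>M)"
proof -
  let ?F = "{Q \<in> R. ennreal \<sigma> < (\<integral>\<^sup>+x\<in>Q. ennreal (\<kappa> x) \<partial>M) / emeasure M Q}"
  let ?k = "\<lambda>x. ennreal (\<kappa> x) * indicator {x. \<sigma> / 2 < \<kappa> x} x"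
  have "ennreal (\<sigma> / 2) * emeasure M (\<Union>?F) \<le> ennreal D * (\<integral>\<^sup>+x. ?k x \<partial>M)"
  proof (rule weak_type_countable)
    show "countable ?F" "?F \<subseteq> cubes" using R by (auto intro: countable_subset)
    show "?k \<in> borel_measurable M" by measurable
    fix Q assume Q: "Q \<in> ?F"
    then have Qc: "Q \<in> cubes" using R by auto
    have [measurable]: "Q \<in> sets lebesgue" using Qc by (rule cube_sets)
    have fin: "emeasure M Q \<noteq> \<infinity>" "emeasure M Q \<noteq> 0" using cube_finite[OF Qc] cube_pos[OF Qc] by auto
    have "ennreal \<sigma> * emeasure M Q \<le> (\<integral>\<^sup>+x\<in>Q. ennreal (\<kappa> x) \<partial>M) / emeasure M Q * emeasure M Q"
      using Q by (intro mult_right_mono) auto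
    also have "\<dots> = (\<integral>\<^sup>+x\<in>Q. ennreal (\<kappa> x) \<partial>M)"
      using fin by (simp add: ennreal_divide_times ennreal_divide_self less_top)
    also have "\<dots> \<le> (\<integral>\<^sup>+x. ?k x * indicator Q x + ennreal (\<sigma> / 2) * indicator Q x \<partial>M)"
      using \<sigma> by (intro nn_integral_mono) (auto split: split_indicator intro!: ennreal_leI simp: not_less)
    also have "\<dots> = (\<integral>\<^sup>+x\<in>Q. ?k x \<partial>M) + ennreal (\<sigma> / 2) * emeasure M Q"
      by (subst nn_integral_add) (auto simp: nn_integral_cmult)
    finally have "ennreal (\<sigma> / 2) * emeasure M Q + ennreal (\<sigma> / 2) * emeasure M Q
      \<le> ennreal (\<sigma> / 2) * emeasure M Q + (\<integral>\<^sup>+x\<in>Q. ?k x \<partial>M)"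
      using \<sigma> by (simp add: distrib_right[symmetric] ennreal_plus[symmetric] add.commute del: ennreal_plus)
    then show "ennreal (\<sigma> / 2) * emeasure M Q \<le> (\<integral>\<^sup>+x\<in>Q. ?k x \<partial>M)"
      using fin by (subst (asm) ennreal_add_left_cancel_le) (auto simp: ennreal_mult_eq_top_iff)
  qed
  then have "ennreal (2 / \<sigma>) * (ennreal (\<sigma> / 2) * emeasure M (\<Union>?F)) \<le> ennreal (2 / \<sigma>) * (ennreal D * (\<integral>\<^sup>+x. ?k x \<partial>M))"
    by (rule mult_left_mono) auto
  then show ?thesis
    using \<sigma> D_pos by (simp add: mult.assoc[symmetric] ennreal_mult[symmetric])
qed

text \<open>Marcinkiewicz interpolation. The power is applied to the averages before the supremum is taken, so
  that the layer cake formula applies directly: \<open>S > \<tau>\<close> means that some average exceeds \<open>\<tau>\<^bsup>1/P\<^esup>\<close>.\<close>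

theorem strong_type_maximal:
  assumes R: "countable R" "R \<subseteq> cubes" and [measurable]: "\<kappa> \<in> borel_measurable M"
    and \<kappa>: "\<And>x. 0 \<le> \<kappa> x" and P: "1 < P"
  shows "(\<integral>\<^sup>+x. (SUP Q\<in>R. indicator Q x * epowr ((\<integral>\<^sup>+y\<in>Q. ennreal (\<kappa> y) \<partial>M) / emeasure M Q) P) \<partial>M)
    \<le> ennreal (D * 2 powr P * P / (P - 1)) * (\<integral>\<^sup>+x. ennreal (\<kappa> x powr P) \<partial>M)"
proof -
  let ?N = "\<lambda>Q. (\<integral>\<^sup>+y\<in>Q. ennreal (\<kappa> y) \<partial>M) / emeasure M Q"
  define S where "S x = (SUP Q\<in>R. indicator Q x * epowr (?N Q) P)" for x
  define b where "b = 1 / P"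
  have b: "0 < b" "b < 1" using P by (auto simp: b_def)
  interpret sigma_finite_measure M by (rule M_sigma_finite)
  interpret P: pair_sigma_finite lborel M ..
  have R_sets: "Q \<in> R \<Longrightarrow> Q \<in> sets lebesgue" for Q using R by auto
  have [measurable]: "S \<in> borel_measurable M"
    unfolding S_def using R(1) by (intro borel_measurable_SUP) (auto intro!: borel_measurable_times_ennreal borel_measurable_indicator R_sets)
  \<comment> \<open>At \<open>\<tau> = 0\<close> the weak type estimate says nothing; a single point does not affect the integral.\<close>
  have level: "indicator {0..} \<tau> * emeasure M {x \<in> space M. ennreal \<tau> < S x}
      \<le> (\<integral>\<^sup>+x. ennreal (2 * D * \<kappa> x) * (ennreal (\<tau> powr (-b)) * indicator {0..(2 * \<kappa> x) powr P} \<tau>) \<partial>M)"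
    if "\<tau> \<noteq> 0" for \<tau> :: real
  proof (cases "0 < \<tau>")
    case True
    define \<sigma> where "\<sigma> = \<tau> powr b"
    have \<sigma>: "0 < \<sigma>" using True by (simp add: \<sigma>_def)
    have U: "\<Union>{Q \<in> R. ennreal \<sigma> < ?N Q} \<in> sets M"
      using R by (intro sets.countable_Union) (auto intro: countable_subset)
    have "{x \<in> space M. ennreal \<tau> < S x} \<subseteq> \<Union>{Q \<in> R. ennreal \<sigma> < ?N Q}"
    proof
      fix x assume "x \<in> {x \<in> space M. ennreal \<tau> < S x}"
      then obtain Q where Q: "Q \<in> R" "ennreal \<tau> < indicator Q x * epowr (?N Q) P"
        unfolding S_def by (auto simp: less_SUP_iff)
      then have "x \<in> Q" "ennreal \<tau> < epowr (?N Q) P" by (auto split: split_indicator_asm)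
      then show "x \<in> \<Union>{Q \<in> R. ennreal \<sigma> < ?N Q}"
        using less_epowr_imp[of \<tau> "?N Q" P] True P Q by (auto simp: \<sigma>_def b_def)
    qed
    then have "emeasure M {x \<in> space M. ennreal \<tau> < S x} \<le> emeasure M (\<Union>{Q \<in> R. ennreal \<sigma> < ?N Q})"
      using U by (intro emeasure_mono)
    also have "\<dots> \<le> ennreal (2 * D / \<sigma>) * (\<integral>\<^sup>+x. ennreal (\<kappa> x) * indicator {x. \<sigma> / 2 < \<kappa> x} x \<partial>M)"
      using R \<sigma> by (intro emeasure_high_average) auto
    also have "\<dots> = (\<integral>\<^sup>+x. ennreal (2 * D / \<sigma>) * (ennreal (\<kappa> x) * indicator {x. \<sigma> / 2 < \<kappa> x} x) \<partial>M)"
      by (rule nn_integral_cmult[symmetric]) measurable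
    also have "\<dots> \<le> (\<integral>\<^sup>+x. ennreal (2 * D * \<kappa> x) * (ennreal (\<tau> powr (-b)) * indicator {0..(2 * \<kappa> x) powr P} \<tau>) \<partial>M)"
    proof (rule nn_integral_mono)
      fix x
      show "ennreal (2 * D / \<sigma>) * (ennreal (\<kappa> x) * indicator {x. \<sigma> / 2 < \<kappa> x} x)
        \<le> ennreal (2 * D * \<kappa> x) * (ennreal (\<tau> powr (-b)) * indicator {0..(2 * \<kappa> x) powr P} \<tau>)"
      proof (cases "\<sigma> / 2 < \<kappa> x")
        case True': True
        have "\<tau> = \<sigma> powr P" using True P by (simp add: \<sigma>_def b_def powr_powr)
        also have "\<dots> \<le> (2 * \<kappa> x) powr P" using True' \<sigma> P by (intro powr_mono2) auto
        finally have "\<tau> \<le> (2 * \<kappa> x) powr P" .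
        then show ?thesis using True True' D_pos \<kappa>[of x]
          by (simp add: \<sigma>_def powr_minus ennreal_mult[symmetric] field_simps)
      qed auto
    qed
    finally show ?thesis using True by simp
  qed (use that in auto)
  have "(\<integral>\<^sup>+x. S x \<partial>M) = (\<integral>\<^sup>+\<tau>. indicator {0..} \<tau> * emeasure M {x \<in> space M. ennreal \<tau> < S x} \<partial>lborel)"
    by (rule nn_integral_layer_cake[OF M_sigma_finite]) measurable
  also have "\<dots> \<le> (\<integral>\<^sup>+\<tau>. (\<integral>\<^sup>+x. ennreal (2 * D * \<kappa> x) * (ennreal (\<tau> powr (-b)) * indicator {0..(2 * \<kappa> x) powr P} \<tau>) \<partial>M) \<partial>lborel)"
    using AE_lborel_singleton[of 0] level by (intro nn_integral_mono_AE) auto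
  also have "\<dots> = (\<integral>\<^sup>+x. (\<integral>\<^sup>+\<tau>. ennreal (2 * D * \<kappa> x) * (ennreal (\<tau> powr (-b)) * indicator {0..(2 * \<kappa> x) powr P} \<tau>) \<partial>lborel) \<partial>M)"
    unfolding indicator_def atLeastAtMost_iff by (rule P.Fubini'[symmetric]) measurable
  also have "\<dots> = (\<integral>\<^sup>+x. ennreal (D * 2 powr P * P / (P - 1)) * ennreal (\<kappa> x powr P) \<partial>M)"
  proof (rule nn_integral_cong)
    fix x
    have "(\<integral>\<^sup>+\<tau>. ennreal (2 * D * \<kappa> x) * (ennreal (\<tau> powr (-b)) * indicator {0..(2 * \<kappa> x) powr P} \<tau>) \<partial>lborel)
      = ennreal (2 * D * \<kappa> x) * ennreal (((2 * \<kappa> x) powr P) powr (1 - b) / (1 - b))"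
      using b by (simp add: nn_integral_cmult nn_integral_powr_initial)
    also have "\<dots> = ennreal (2 * D * \<kappa> x * (((2 * \<kappa> x) powr P) powr (1 - b) / (1 - b)))"
      using b D_pos \<kappa>[of x] by (intro ennreal_mult[symmetric]) auto
    also have "2 * D * \<kappa> x * (((2 * \<kappa> x) powr P) powr (1 - b) / (1 - b)) = (D * 2 powr P * P / (P - 1)) * \<kappa> x powr P"
    proof (cases "\<kappa> x = 0")
      case False
      then have k: "0 < \<kappa> x" using \<kappa>[of x] by simp
      have "P * (1 - b) = P - 1" using P by (simp add: b_def field_simps)
      then have "2 * D * \<kappa> x * (((2 * \<kappa> x) powr P) powr (1 - b) / (1 - b))
          = D * ((2 * \<kappa> x) * (2 * \<kappa> x) powr (P - 1)) * (1 / (1 - b))"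
        by (simp add: powr_powr)
      moreover have "1 / (1 - b) = P / (P - 1)" using P by (simp add: b_def field_simps)
      moreover have "(2 * \<kappa> x) * (2 * \<kappa> x) powr (P - 1) = (2 * \<kappa> x) powr P"
        using k powr_mult_base[of "2 * \<kappa> x" "P - 1"] by simp
      ultimately have "2 * D * \<kappa> x * (((2 * \<kappa> x) powr P) powr (1 - b) / (1 - b)) = D * (2 * \<kappa> x) powr P * (P / (P - 1))"
        by simp
      then show ?thesis using k by (simp add: powr_mult)
    qed (use P in simp)
    also have "ennreal \<dots> = ennreal (D * 2 powr P * P / (P - 1)) * ennreal (\<kappa> x powr P)"
      using P D_pos by (intro ennreal_mult) auto
    finally show "(\<integral>\<^sup>+\<tau>. ennreal (2 * D * \<kappa> x) * (ennreal (\<tau> powr (-b)) * indicator {0..(2 * \<kappa> x) powr P} \<tau>) \<partial>lborel)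
      = ennreal (D * 2 powr P * P / (P - 1)) * ennreal (\<kappa> x powr P)" .
  qed
  also have "\<dots> = ennreal (D * 2 powr P * P / (P - 1)) * (\<integral>\<^sup>+x. ennreal (\<kappa> x powr P) \<partial>M)"
    by (rule nn_integral_cmult) measurable
  finally show ?thesis unfolding S_def .
qed

text \<open>Passing from an arbitrary cube to the countable family only costs a doubling constant, because the cube from the family
  that contains it has comparable measure.\<close>

lemma average_le_countable_sup:
  assumes \<R>: "\<And>a l. 0 < l \<Longrightarrow> \<exists>b m. cbox b (b + vec m) \<in> \<R> \<and> cbox a (a + vec l) \<subseteq> cbox b (b + vec m) \<and> m \<le> 2 * l"
    and \<R>_cubes: "\<R> \<subseteq> cubes" and Q: "Q \<in> cubes" "x \<in> Q" and a: "0 \<le> a"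
  shows "epowr ((\<integral>\<^sup>+y\<in>Q. g y \<partial>M) / emeasure M Q) a
    \<le> ennreal (D powr a) * (SUP R\<in>\<R>. indicator R x * epowr ((\<integral>\<^sup>+y\<in>R. g y \<partial>M) / emeasure M R) a)"
proof -
  obtain c l where l: "0 < l" "Q = cbox c (c + vec l)" using Q(1) by (rule cubesE)
  obtain b m where R: "cbox b (b + vec m) \<in> \<R>" "Q \<subseteq> cbox b (b + vec m)" "m \<le> 2 * l"
    using \<R>[OF l(1), of c] l(2) by auto
  define R where "R = cbox b (b + vec m)"
  have Rc: "R \<in> cubes" using R(1) \<R>_cubes by (auto simp: R_def)
  have "1 \<le> real CARD('n)" by (simp add: Suc_le_eq)
  then have "2 \<le> 10 * real CARD('n)" by linarith
  then have "2 * l \<le> 10 * real CARD('n) * l" using l(1) by (intro mult_right_mono) auto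
  then have m: "m \<le> 10 * real CARD('n) * l" using R(3) by linarith
  have MR: "emeasure M R \<le> ennreal D * emeasure M Q"
    unfolding R_def l(2) by (rule growth[OF l(1) _ m]) (use R(2) l(2) in simp)
  have "(\<integral>\<^sup>+y\<in>Q. g y \<partial>M) \<le> (\<integral>\<^sup>+y\<in>R. g y \<partial>M)"
    using R(2) by (intro nn_integral_mono) (auto simp: R_def split: split_indicator)
  also have "\<dots> = (\<integral>\<^sup>+y\<in>R. g y \<partial>M) / emeasure M R * emeasure M R"
    using cube_pos[OF Rc] cube_finite[OF Rc] by (simp add: ennreal_divide_times ennreal_divide_self less_top)
  also have "\<dots> \<le> (\<integral>\<^sup>+y\<in>R. g y \<partial>M) / emeasure M R * (ennreal D * emeasure M Q)"
    using MR by (rule mult_left_mono) simp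
  also have "\<dots> = emeasure M Q * (ennreal D * ((\<integral>\<^sup>+y\<in>R. g y \<partial>M) / emeasure M R))" by (simp only: mult_ac)
  finally have "(\<integral>\<^sup>+y\<in>Q. g y \<partial>M) / emeasure M Q \<le> ennreal D * ((\<integral>\<^sup>+y\<in>R. g y \<partial>M) / emeasure M R)"
    by (rule divide_le_posI_ennreal[OF cube_pos[OF Q(1)]])
  then have "epowr ((\<integral>\<^sup>+y\<in>Q. g y \<partial>M) / emeasure M Q) a \<le> epowr (ennreal D * ((\<integral>\<^sup>+y\<in>R. g y \<partial>M) / emeasure M R)) a"
    using a by (intro epowr_mono)
  also have "\<dots> = ennreal (D powr a) * (indicator R x * epowr ((\<integral>\<^sup>+y\<in>R. g y \<partial>M) / emeasure M R) a)"
    using R(2) Q(2) D_pos by (subst epowr_ennreal_mult) (auto simp: R_def)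
  also have "\<dots> \<le> ennreal (D powr a) * (SUP R\<in>\<R>. indicator R x * epowr ((\<integral>\<^sup>+y\<in>R. g y \<partial>M) / emeasure M R) a)"
    using R(1) by (intro mult_left_mono SUP_upper) (auto simp: R_def)
  finally show ?thesis .
qed

text \<open>Jensen's inequality for a power \<open>b < 1\<close>; it also shows that the average of \<open>k\<^sup>b\<close> is a real number \<open>N\<close>.\<close>

lemma average_powr_Jensen:
  assumes [measurable]: "k \<in> borel_measurable M" and k: "\<And>x. 0 \<le> k x" and Q: "Q \<in> cubes"
    and H: "(\<integral>\<^sup>+x. ennreal (k x) \<partial>M) = ennreal H" "0 \<le> H" and b: "0 < b" "b < 1"
  obtains N where "0 \<le> N" "(\<integral>\<^sup>+x\<in>Q. ennreal (k x powr b) \<partial>M) = ennreal (measure M Q * N)"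
    "N powr (1 / b) \<le> H / measure M Q"
proof -
  have Qs [measurable]: "Q \<in> sets lebesgue" using Q by (rule cube_sets)
  define V where "V = measure M Q"
  have eV: "emeasure M Q = ennreal V" unfolding V_def using cube_finite[OF Q] by (simp add: emeasure_eq_ennreal_measure less_top)
  have V: "0 < V" using cube_pos[OF Q] eV by simp
  have "(\<integral>\<^sup>+x\<in>Q. ennreal (k x powr b) \<partial>M) = (\<integral>\<^sup>+x. ennreal (k x powr b * indicator Q x powr (1 - b)) \<partial>M)"
    by (intro nn_integral_cong) (auto split: split_indicator)
  also have "\<dots> \<le> ennreal (H powr b * V powr (1 - b))"
  proof (rule nn_integral_powr_product_le)
    show "(\<integral>\<^sup>+x. ennreal (indicator Q x) \<partial>M) \<le> ennreal V" using eV Qs by (simp add: ennreal_indicator)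
  qed (use k H b V in auto)
  finally have le: "(\<integral>\<^sup>+x\<in>Q. ennreal (k x powr b) \<partial>M) \<le> ennreal (H powr b * V powr (1 - b))" .
  then obtain I where I: "0 \<le> I" "(\<integral>\<^sup>+x\<in>Q. ennreal (k x powr b) \<partial>M) = ennreal I"
    by (cases "\<integral>\<^sup>+x\<in>Q. ennreal (k x powr b) \<partial>M") (auto simp: top_unique)
  show thesis
  proof
    show "0 \<le> I / V" using I V by simp
    show "(\<integral>\<^sup>+x\<in>Q. ennreal (k x powr b) \<partial>M) = ennreal (measure M Q * (I / V))" using I V by (simp add: V_def)
    have "I \<le> H powr b * V powr (1 - b)" using le I by (simp add: ennreal_le_iff)
    then have "I / V \<le> H powr b * V powr (1 - b) / V" using V by (intro divide_right_mono) auto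
    also have "\<dots> = (H / V) powr b" using V H by (simp add: powr_diff powr_divide)
    finally have "(I / V) powr (1 / b) \<le> ((H / V) powr b) powr (1 / b)" using I V b by (intro powr_mono2) auto
    also have "\<dots> = H / V" using V H b by (simp add: powr_powr)
    finally show "(I / V) powr (1 / b) \<le> H / measure M Q" unfolding V_def .
  qed
qed

end

section \<open>A function is dominated by the supremum of its averages\<close>

text \<open>The following three lemmas give the half of Lebesgue's differentiation theorem that compares a function with its
  averages from above. If \<open>w \<ge> \<beta>\<close> on \<open>A\<close> while all averages over cubes meeting \<open>A\<close> are at most \<open>\<alpha> < \<beta>\<close>, then a covering
  of \<open>A\<close> by almost disjoint cubes inside an open set \<open>U\<close> shows that \<open>A\<close> lies in a set of measure at most
  \<open>\<alpha>/\<beta>\<close> times that of \<open>U\<close>. Iterating this shrinks the outer measure of \<open>A\<close> to zero. The set \<open>A\<close> may be arbitrary, which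
  avoids all measurability questions about the supremum over uncountably many cubes.\<close>

lemma small_open_superset_step:
  fixes A :: "(real ^ 'n) set" and w :: "real ^ 'n \<Rightarrow> ennreal"
  assumes [measurable]: "w \<in> borel_measurable lebesgue"
    and A: "A \<subseteq> cbox a (a + vec L)" "0 < L" and U: "open U" "A \<subseteq> U"
    and \<beta>: "\<And>x. x \<in> A \<Longrightarrow> \<beta> \<le> w x"
    and \<alpha>: "\<And>x Q. x \<in> A \<Longrightarrow> Q \<in> cubes \<Longrightarrow> x \<in> Q \<Longrightarrow> average Q w \<le> \<alpha>"
  obtains D where "D \<in> sets lebesgue" "A \<subseteq> D" "\<beta> * emeasure lebesgue D \<le> \<alpha> * emeasure lebesgue U"
proof -
  define g where "g x = (if x \<in> U then U else UNIV)" for x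
  have "gauge g" unfolding gauge_def g_def using U by auto
  moreover have "box a (a + vec L) \<noteq> {}" using A(2) by (auto simp: interval_ne_empty_cart)
  ultimately obtain \<D> where \<D>:
    "countable \<D>"
    "\<And>K. K \<in> \<D> \<Longrightarrow> interior K \<noteq> {} \<and> (\<exists>c d. K = cbox c d)"
    "pairwise (\<lambda>A B. interior A \<inter> interior B = {}) \<D>"
    "\<And>K. K \<in> \<D> \<Longrightarrow> \<exists>x \<in> A \<inter> K. K \<subseteq> g x"
    "\<And>u v. cbox u v \<in> \<D> \<Longrightarrow> \<exists>n. \<forall>i \<in> Basis. v \<bullet> i - u \<bullet> i = ((a + vec L) \<bullet> i - a \<bullet> i) / 2^n"
    "A \<subseteq> \<Union>\<D>"
    using covering_lemma[OF A(1), of g] by metis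
  have cube: "K \<in> cubes" if KD: "K \<in> \<D>" for K
  proof -
    obtain c d where K: "K = cbox c d" using \<D>(2)[OF KD] by auto
    then obtain n where n: "\<forall>i \<in> Basis. d \<bullet> i - c \<bullet> i = ((a + vec L) \<bullet> i - a \<bullet> i) / 2^n"
      using \<D>(5) \<open>K \<in> \<D>\<close> by blast
    have "d $ i - c $ i = L / 2 ^ n" for i
      using n[rule_format, of "axis i 1"] by (simp add: inner_axis axis_in_Basis_iff)
    then have "d = c + vec (L / 2 ^ n)" by (simp add: vec_eq_iff algebra_simps)
    then show ?thesis using K A(2) by (auto intro: cubesI)
  qed
  have int_meas: "emeasure lebesgue K = emeasure lebesgue (interior K)" and null: "K - interior K \<in> null_sets lebesgue"
    if K: "K \<in> \<D>" for K
  proof -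
    obtain c d where "K = cbox c d" using \<D>(2)[OF K] by auto
    then show n: "K - interior K \<in> null_sets lebesgue"
      using negligible_frontier_interval by (simp add: negligible_iff_null_sets interior_cbox)
    show "emeasure lebesgue K = emeasure lebesgue (interior K)"
      using emeasure_Diff_null_set[OF n, of K] cube[OF K]
      by (simp add: Diff_Diff_Int Int_absorb1 interior_subset)
  qed
  define G where "G = (\<Union>K\<in>\<D>. interior K)"
  define Z where "Z = (\<Union>K\<in>\<D>. K - interior K)"
  define D where "D = (G \<inter> {x. \<beta> \<le> w x}) \<union> Z"
  have Z: "Z \<in> null_sets lebesgue" unfolding Z_def using \<D>(1) null by (intro null_sets_UN') auto
  have G_open: "open G" unfolding G_def by auto
  have G_sets [measurable]: "G \<in> sets lebesgue" using G_open by (simp add: borel_open)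
  have GU: "G \<subseteq> U"
  proof
    fix x assume "x \<in> G"
    then obtain K where K: "K \<in> \<D>" "x \<in> K" unfolding G_def using interior_subset by blast
    obtain y where "y \<in> A" "K \<subseteq> g y" using \<D>(4)[OF K(1)] by auto
    then show "x \<in> U" using K U by (auto simp: g_def split: if_splits)
  qed
  have D_sets: "G \<inter> {x. \<beta> \<le> w x} \<in> sets lebesgue" by measurable
  have disj: "disjoint_family_on interior \<D>"
    using \<D>(3) by (auto simp: disjoint_family_on_def pairwise_def)
  show thesis
  proof
    show "D \<in> sets lebesgue" unfolding D_def using D_sets Z by auto
    show "A \<subseteq> D"
      using \<D>(6) \<beta> unfolding D_def G_def Z_def by blast
    have "emeasure lebesgue D = emeasure lebesgue (G \<inter> {x. \<beta> \<le> w x})"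
      unfolding D_def using Z D_sets by (simp add: emeasure_Un_null_set)
    then have "\<beta> * emeasure lebesgue D = (\<integral>\<^sup>+x\<in>G \<inter> {x. \<beta> \<le> w x}. \<beta> \<partial>lebesgue)"
      using D_sets by (simp add: nn_integral_cmult_indicator)
    also have "\<dots> \<le> (\<integral>\<^sup>+x\<in>G. w x \<partial>lebesgue)"
      by (intro nn_integral_mono) (auto split: split_indicator)
    also have "\<dots> = emeasure (density lebesgue w) G" by (simp add: emeasure_density)
    also have "\<dots> = (\<integral>\<^sup>+K. emeasure (density lebesgue w) (interior K) \<partial>count_space \<D>)"
      unfolding G_def using \<D>(1) disj by (intro emeasure_UN_countable) auto
    also have "\<dots> \<le> (\<integral>\<^sup>+K. \<alpha> * emeasure lebesgue (interior K) \<partial>count_space \<D>)"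
    proof (intro nn_integral_mono)
      fix K assume "K \<in> space (count_space \<D>)"
      then have K: "K \<in> \<D>" by simp
      obtain y where y: "y \<in> A" "y \<in> K" using \<D>(4)[OF K] by auto
      have "emeasure (density lebesgue w) (interior K) = (\<integral>\<^sup>+x\<in>interior K. w x \<partial>lebesgue)"
        by (simp add: emeasure_density)
      also have "\<dots> \<le> (\<integral>\<^sup>+x\<in>K. w x \<partial>lebesgue)"
        using interior_subset[of K] by (intro nn_integral_mono) (auto split: split_indicator)
      also have "\<dots> = average K w * emeasure lebesgue K" using cube[OF K] by (rule nn_integral_cube_eq_average)
      also have "\<dots> \<le> \<alpha> * emeasure lebesgue K" using \<alpha>[OF y(1) cube[OF K] y(2)] by (rule mult_right_mono) auto
      finally show "emeasure (density lebesgue w) (interior K) \<le> \<alpha> * emeasure lebesgue (interior K)"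
        using int_meas[OF K] by simp
    qed
    also have "\<dots> = \<alpha> * (\<integral>\<^sup>+K. emeasure lebesgue (interior K) \<partial>count_space \<D>)"
      by (rule nn_integral_cmult) auto
    also have "(\<integral>\<^sup>+K. emeasure lebesgue (interior K) \<partial>count_space \<D>) = emeasure lebesgue G"
      unfolding G_def using \<D>(1) disj by (intro emeasure_UN_countable[symmetric]) auto
    also have "\<alpha> * \<dots> \<le> \<alpha> * emeasure lebesgue U" using GU U(1)
      by (intro mult_left_mono emeasure_mono) auto
    finally show "\<beta> * emeasure lebesgue D \<le> \<alpha> * emeasure lebesgue U" .
  qed
qed

lemma null_set_if_averages_small:
  fixes A :: "(real ^ 'n) set" and w :: "real ^ 'n \<Rightarrow> ennreal" and \<alpha> \<beta> :: real
  assumes [measurable]: "w \<in> borel_measurable lebesgue"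
    and A: "A \<subseteq> ball 0 L" "0 < L" and \<alpha>\<beta>: "0 \<le> \<alpha>" "\<alpha> < \<beta>"
    and \<beta>: "\<And>x. x \<in> A \<Longrightarrow> ennreal \<beta> \<le> w x"
    and \<alpha>: "\<And>x Q. x \<in> A \<Longrightarrow> Q \<in> cubes \<Longrightarrow> x \<in> Q \<Longrightarrow> average Q w \<le> ennreal \<alpha>"
  shows "A \<in> null_sets lebesgue"
proof -
  have "\<alpha> / \<beta> < 1" using \<alpha>\<beta> by simp
  then obtain \<rho> where \<rho>: "\<alpha> / \<beta> < \<rho>" "\<rho> < 1" using dense by blast
  have "0 \<le> \<alpha> / \<beta>" using \<alpha>\<beta> by simp
  then have \<rho>0: "0 < \<rho>" using \<rho> by linarith
  have box: "A \<subseteq> cbox (0 - vec L) (0 - vec L + vec (2 * L))"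
    using A(1) ball_subset_cball cball_subset_cube[of 0 L] by blast
  have L2: "0 < 2 * L" using A(2) by simp
  \<comment> \<open>The summand \<open>1\<close> keeps \<open>m\<close> positive, so that every step below has room for an error \<open>e > 0\<close>.\<close>
  define m where "m = measure lebesgue (ball (0 :: real ^ 'n) L) + 1"
  have m: "0 < m" unfolding m_def by (simp add: add_nonneg_pos)
  have ex: "\<exists>U. open U \<and> A \<subseteq> U \<and> emeasure lebesgue U \<le> ennreal (\<rho> ^ k * m)" for k
  proof (induction k)
    case 0
    have "emeasure lebesgue (ball (0 :: real ^ 'n) L) = measure lebesgue (ball (0 :: real ^ 'n) L)"
      by (rule emeasure_eq_measure2) simp
    then show ?case using A(1) by (intro exI[of _ "ball 0 L"]) (auto simp: m_def intro!: ennreal_leI)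
  next
    case (Suc k)
    then obtain U where U: "open U" "A \<subseteq> U" "emeasure lebesgue U \<le> ennreal (\<rho> ^ k * m)" by auto
    obtain D where D: "D \<in> sets lebesgue" "A \<subseteq> D" "ennreal \<beta> * emeasure lebesgue D \<le> ennreal \<alpha> * emeasure lebesgue U"
      by (rule small_open_superset_step[OF assms(1) box L2 U(1,2) \<beta> \<alpha>])
    have "ennreal (1 / \<beta>) * (ennreal \<beta> * emeasure lebesgue D) \<le> ennreal (1 / \<beta>) * (ennreal \<alpha> * ennreal (\<rho> ^ k * m))"
      by (rule mult_left_mono[OF order_trans[OF D(3) mult_left_mono[OF U(3)]]]) auto
    moreover have "ennreal (1 / \<beta>) * (ennreal \<beta> * emeasure lebesgue D) = emeasure lebesgue D"
      using \<alpha>\<beta> by (simp add: mult.assoc[symmetric] ennreal_mult[symmetric])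
    moreover have "ennreal (1 / \<beta>) * (ennreal \<alpha> * ennreal (\<rho> ^ k * m)) = ennreal (\<alpha> / \<beta> * (\<rho> ^ k * m))"
      using \<alpha>\<beta> \<rho> \<rho>0 m by (simp add: ennreal_mult[symmetric])
    ultimately have De: "emeasure lebesgue D \<le> ennreal (\<alpha> / \<beta> * (\<rho> ^ k * m))" by simp
    define e where "e = (\<rho> - \<alpha> / \<beta>) * (\<rho> ^ k * m)"
    have e: "0 < e" using \<rho> \<rho>0 m by (simp add: e_def)
    obtain T where T: "open T" "D \<subseteq> T" "T - D \<in> lmeasurable" "emeasure lebesgue (T - D) < ennreal e"
      by (rule sets_lebesgue_outer_open[OF D(1) e])
    have "D \<union> (T - D) = T" using T(2) by blast
    then have "emeasure lebesgue T = emeasure lebesgue D + emeasure lebesgue (T - D)"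
      using plus_emeasure[OF D(1) fmeasurableD[OF T(3)]] by (metis Diff_disjoint)
    also have "\<dots> \<le> ennreal (\<alpha> / \<beta> * (\<rho> ^ k * m)) + ennreal e" using De less_imp_le[OF T(4)] by (rule add_mono)
    also have "\<dots> = ennreal (\<rho> ^ Suc k * m)"
      using \<alpha>\<beta> \<rho> \<rho>0 m e by (subst ennreal_plus[symmetric]) (auto simp: e_def algebra_simps)
    finally show ?case using T D by (intro exI[of _ T]) auto
  qed
  then obtain U where U: "\<And>k. open (U k) \<and> A \<subseteq> U k \<and> emeasure lebesgue (U k) \<le> ennreal (\<rho> ^ k * m)" by metis
  have [measurable]: "\<And>k. U k \<in> sets lebesgue" using U by (simp add: borel_open)
  have le: "emeasure lebesgue (\<Inter>k. U k) \<le> ennreal (\<rho> ^ k * m)" for k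
  proof -
    have "emeasure lebesgue (\<Inter>k. U k) \<le> emeasure lebesgue (U k)" by (intro emeasure_mono) auto
    with U[of k] show ?thesis by auto
  qed
  have "(\<lambda>k. \<rho> ^ k * m) \<longlonglongrightarrow> 0 * m" using \<rho> \<rho>0 by (intro tendsto_mult LIMSEQ_realpow_zero tendsto_const) auto
  then have "(\<lambda>k. ennreal (\<rho> ^ k * m)) \<longlonglongrightarrow> ennreal 0" by (intro tendsto_ennrealI) simp
  then have "emeasure lebesgue (\<Inter>k. U k) \<le> ennreal 0" by (rule LIMSEQ_le_const) (use le in auto)
  then have "(\<Inter>k. U k) \<in> null_sets lebesgue" by (intro null_setsI) auto
  moreover have "A \<subseteq> (\<Inter>k. U k)" using U by auto
  ultimately show ?thesis by (metis negligible_iff_null_sets negligible_subset)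
qed

theorem AE_le_maximal:
  fixes w :: "real ^ 'n \<Rightarrow> ennreal"
  assumes w: "w \<in> borel_measurable lebesgue"
  shows "AE x in lebesgue. w x \<le> (SUP Q\<in>{Q \<in> cubes. x \<in> Q}. average Q w)"
proof -
  let ?S = "\<lambda>x. SUP Q\<in>{Q \<in> cubes. x \<in> Q}. average Q w"
  define A where "A = (\<lambda>(\<alpha>, \<beta>, L). {x \<in> ball 0 (real (Suc L)). ennreal (real_of_rat \<beta>) \<le> w x \<and> ?S x \<le> ennreal (real_of_rat \<alpha>)})"
  have "A (\<alpha>, \<beta>, L) \<in> null_sets lebesgue" if "0 \<le> \<alpha>" "\<alpha> < \<beta>" for \<alpha> \<beta> L
  proof (rule null_set_if_averages_small[OF w, where \<alpha> = "real_of_rat \<alpha>" and \<beta> = "real_of_rat \<beta>" and L = "real (Suc L)"])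
    fix x Q assume x: "x \<in> A (\<alpha>, \<beta>, L)" "Q \<in> cubes" "x \<in> Q"
    then have "average Q w \<le> ?S x" by (intro SUP_upper) auto
    with x show "average Q w \<le> ennreal (real_of_rat \<alpha>)" by (auto simp: A_def)
  qed (use that in \<open>auto simp: A_def of_rat_less\<close>)
  then have "(\<Union>p\<in>{(\<alpha>, \<beta>, L). 0 \<le> \<alpha> \<and> \<alpha> < \<beta>}. A p) \<in> null_sets lebesgue"
    by (intro null_sets_UN') auto
  moreover have "{x \<in> space lebesgue. \<not> w x \<le> ?S x} \<subseteq> (\<Union>p\<in>{(\<alpha>, \<beta>, L). 0 \<le> \<alpha> \<and> \<alpha> < \<beta>}. A p)"
  proof
    fix x assume "x \<in> {x \<in> space lebesgue. \<not> w x \<le> ?S x}"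
    then have lt: "?S x < w x" by auto
    then obtain a where a: "?S x < ennreal (real_of_rat a)" "ennreal (real_of_rat a) < w x"
      using ennreal_rat_dense by blast
    then obtain b where b: "ennreal (real_of_rat a) < ennreal (real_of_rat b)" "ennreal (real_of_rat b) < w x"
      using ennreal_rat_dense by blast
    have a0: "0 < a" using a(1) by (metis ennreal_neg not_less not_less_zero of_rat_less_0_iff zero_less_of_rat_iff)
    have ab: "a < b" using b(1) a0 by (metis ennreal_less_iff of_rat_less order_less_imp_le zero_le_of_rat_iff)
    obtain L where "norm x < real L" using reals_Archimedean2 by blast
    then have "x \<in> A (a, b, L)" using a b by (auto simp: A_def)
    then show "x \<in> (\<Union>p\<in>{(\<alpha>, \<beta>, L). 0 \<le> \<alpha> \<and> \<alpha> < \<beta>}. A p)" using a0 ab by (intro UN_I[of "(a, b, L)"]) auto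
  qed
  ultimately show ?thesis by (rule AE_I')
qed

section \<open>Weights\<close>

lemma locally_integrable_measurable:
  fixes w :: "real ^ 'n \<Rightarrow> real"
  assumes "locally_integrable w"
  shows "w \<in> borel_measurable lebesgue"
proof (rule borel_measurable_LIMSEQ_metric)
  fix N :: nat
  have "set_integrable lebesgue (cball 0 (real N)) w"
    using assms by (simp add: locally_integrable_def)
  then show "(\<lambda>x. indicator (cball 0 (real N)) x *\<^sub>R w x) \<in> borel_measurable lebesgue"
    unfolding set_integrable_def by (rule borel_measurable_integrable)
next
  fix x :: "real ^ 'n"
  obtain N0 where N0: "norm x < real N0" using reals_Archimedean2 by blast
  show "(\<lambda>N. indicator (cball 0 (real N)) x *\<^sub>R w x) \<longlonglongrightarrow> w x"
  proof (rule tendsto_eventually, rule eventually_sequentiallyI)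
    fix N assume "N0 \<le> N"
    then show "indicator (cball 0 (real N)) x *\<^sub>R w x = w x" using N0 by (simp add: indicator_def)
  qed
qed

lemma locally_integrable_nn_integral_cube:
  assumes "locally_integrable w" "Q \<in> cubes"
  shows "(\<integral>\<^sup>+x\<in>Q. ennreal (w x) \<partial>lebesgue) < \<infinity>"
proof -
  have "compact Q" using assms(2) by (auto simp: cubes_def)
  then have "integrable lebesgue (\<lambda>x. indicator Q x *\<^sub>R w x)"
    using assms(1) by (auto simp: locally_integrable_def set_integrable_def)
  then have "(\<integral>\<^sup>+x. ennreal (norm (indicator Q x *\<^sub>R w x)) \<partial>lebesgue) < \<infinity>"
    by (simp add: integrable_iff_bounded)
  moreover have "(\<integral>\<^sup>+x\<in>Q. ennreal (w x) \<partial>lebesgue) \<le> (\<integral>\<^sup>+x. ennreal (norm (indicator Q x *\<^sub>R w x)) \<partial>lebesgue)"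
    by (intro nn_integral_mono) (auto split: split_indicator intro: ennreal_leI)
  ultimately show ?thesis by (rule le_less_trans[rotated])
qed

lemma weight_nn_integral_cube_pos:
  assumes "weight w" "Q \<in> cubes"
  shows "0 < (\<integral>\<^sup>+x\<in>Q. ennreal (w x) \<partial>lebesgue)"
proof (rule ccontr)
  have [measurable]: "w \<in> borel_measurable lebesgue" "Q \<in> sets lebesgue"
    using assms by (auto simp: weight_def intro: locally_integrable_measurable)
  assume "\<not> ?thesis"
  then have "(\<integral>\<^sup>+x\<in>Q. ennreal (w x) \<partial>lebesgue) = 0" by simp
  then have "AE x in lebesgue. ennreal (w x) * indicator Q x = 0"
    by (subst (asm) nn_integral_0_iff_AE) auto
  moreover have "AE x in lebesgue. 0 < w x" using assms by (simp add: weight_def)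
  ultimately have "AE x in lebesgue. x \<notin> Q"
    by eventually_elim (auto split: split_indicator_asm)
  then have "emeasure lebesgue Q = 0"
    by (subst (asm) AE_iff_null_sets[symmetric]) auto
  then show False using cube_emeasure_pos_finite(1)[OF assms(2)] by simp
qed

text \<open>The essential infimum is a supremum of admissible lower bounds that is not evidently attained;
  doubling the constant makes room for an admissible bound.\<close>

lemma A_one_average_le:
  fixes u :: "real ^ 'n \<Rightarrow> real"
  assumes "u \<in> A_one"
  obtains A where "0 < A"
    "\<And>Q. Q \<in> cubes \<Longrightarrow> AE x in lebesgue. x \<in> Q \<longrightarrow> average Q (\<lambda>x. ennreal (u x)) \<le> ennreal A * ennreal (u x)"
proof -
  obtain C where w: "weight u" and C: "0 < C"
    "\<And>Q. Q \<in> cubes \<Longrightarrow> average Q (\<lambda>x. ennreal (u x)) \<le> ennreal C * essential_inf Q u"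
    using assms by (auto simp: A_one_def)
  show thesis
  proof
    show "0 < 2 * C" using C by simp
    fix Q :: "(real ^ 'n) set" assume Q: "Q \<in> cubes"
    obtain I where I: "0 \<le> I" "(\<integral>\<^sup>+x\<in>Q. ennreal (u x) \<partial>lebesgue) = ennreal I"
      using locally_integrable_nn_integral_cube[OF _ Q, of u] w
      by (cases "\<integral>\<^sup>+x\<in>Q. ennreal (u x) \<partial>lebesgue") (auto simp: weight_def)
    define a where "a = I / measure lebesgue Q"
    have a: "0 \<le> a" "average Q (\<lambda>x. ennreal (u x)) = ennreal a"
      unfolding average_def I(2) cube_emeasure_pos_finite(4)[OF Q] a_def
      using I(1) cube_emeasure_pos_finite(3)[OF Q] by (auto simp: divide_ennreal)
    show "AE x in lebesgue. x \<in> Q \<longrightarrow> average Q (\<lambda>x. ennreal (u x)) \<le> ennreal (2 * C) * ennreal (u x)"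
    proof (cases "a = 0")
      case False
      have "ennreal (a / (2 * C)) < essential_inf Q u"
      proof (rule ccontr)
        assume "\<not> ?thesis"
        then have "ennreal C * essential_inf Q u \<le> ennreal C * ennreal (a / (2 * C))" by (intro mult_left_mono) auto
        with C(2)[OF Q] have "ennreal a \<le> ennreal C * ennreal (a / (2 * C))" unfolding a(2) by simp
        also have "\<dots> = ennreal (a / 2)" using C(1) a(1) by (simp add: ennreal_mult[symmetric])
        finally show False using a False by simp
      qed
      then obtain c where c: "AE x in lebesgue. x \<in> Q \<longrightarrow> c \<le> ennreal (u x)" "ennreal (a / (2 * C)) < c"
        unfolding essential_inf_def less_Sup_iff by auto
      from c(1) show ?thesis
      proof eventually_elim
        case (elim x)
        show ?case
        proof
          assume "x \<in> Q"
          have "ennreal a = ennreal (2 * C) * ennreal (a / (2 * C))"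
            using C(1) a(1) by (simp add: ennreal_mult[symmetric])
          also have "\<dots> \<le> ennreal (2 * C) * ennreal (u x)"
            using elim \<open>x \<in> Q\<close> c(2) by (intro mult_left_mono) auto
          finally show "average Q (\<lambda>x. ennreal (u x)) \<le> ennreal (2 * C) * ennreal (u x)" unfolding a(2) .
        qed
      qed
    qed (use a in simp)
  qed
qed

text \<open>Doubling for \<open>A\<^sub>1\<close> weights: the average over the large cube bounds \<open>A u\<close> from below on the
  small one. The power of \<open>10 n\<close> bounds the ratio of the volumes.\<close>

lemma cube_growth_A_one:
  fixes u :: "real ^ 'n \<Rightarrow> real"
  assumes w: "weight u" and A: "0 < A"
    "\<And>Q. Q \<in> cubes \<Longrightarrow> AE x in lebesgue. x \<in> Q \<longrightarrow> average Q (\<lambda>x. ennreal (u x)) \<le> ennreal A * ennreal (u x)"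
  shows "cube_growth (density lebesgue (\<lambda>x. ennreal (u x))) (A * (10 * real CARD('n)) ^ CARD('n))"
proof
  let ?M = "density lebesgue (\<lambda>x. ennreal (u x))"
  have [measurable]: "u \<in> borel_measurable lebesgue"
    using w by (auto simp: weight_def intro: locally_integrable_measurable)
  have M: "emeasure ?M Q = (\<integral>\<^sup>+x\<in>Q. ennreal (u x) \<partial>lebesgue)" if "Q \<in> cubes" for Q
    using that by (subst emeasure_density) auto
  show "sets ?M = sets lebesgue" by simp
  show fin: "emeasure ?M Q < \<infinity>" if "Q \<in> cubes" for Q
    using locally_integrable_nn_integral_cube[OF _ that, of u] w that by (simp add: M weight_def)
  show "0 < emeasure ?M Q" if "Q \<in> cubes" for Q
    using that w by (simp add: M weight_nn_integral_cube_pos)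
  show "0 < A * (10 * real CARD('n)) ^ CARD('n)" using A(1) by simp
  show "\<exists>\<A>. countable \<A> \<and> \<A> \<subseteq> sets ?M \<and> \<Union>\<A> = space ?M \<and> (\<forall>a\<in>\<A>. emeasure ?M a \<noteq> \<infinity>)"
  proof (intro exI conjI)
    let ?c = "\<lambda>N::nat. cbox (0 - vec (real (Suc N))) (0 - vec (real (Suc N)) + vec (2 * real (Suc N))) :: (real ^ 'n) set"
    show "countable (range ?c)" by simp
    show "range ?c \<subseteq> sets ?M" by auto
    have "x \<in> \<Union>(range ?c)" for x
    proof -
      obtain N where "norm x < real N" using reals_Archimedean2 by blast
      then have "x \<in> cball 0 (real (Suc N))" by simp
      then show ?thesis using cball_subset_cube[of 0 "real (Suc N)"] by blast
    qed
    then show "\<Union>(range ?c) = space ?M" by auto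
    show "\<forall>a\<in>range ?c. emeasure ?M a \<noteq> \<infinity>"
    proof
      fix a assume a: "a \<in> range ?c"
      have "?c N \<in> cubes" for N by (rule cubesI) simp
      with a have "a \<in> cubes" by blast
      then show "emeasure ?M a \<noteq> \<infinity>" using fin by (simp add: less_top)
    qed
  qed
  fix l m :: real and a b :: "real ^ 'n"
  assume l: "0 < l" and sub: "cbox a (a + vec l) \<subseteq> cbox b (b + vec m)" and m: "m \<le> 10 * real CARD('n) * l"
  let ?Q = "cbox a (a + vec l)" and ?R = "cbox b (b + vec m)"
  have "a \<in> ?Q" "a + vec l \<in> ?Q" using l by (auto simp: mem_box_cart)
  then have "a \<in> ?R" "a + vec l \<in> ?R" using sub by auto
  then have "b $ i \<le> a $ i \<and> a $ i + l \<le> b $ i + m" for i by (auto simp: mem_box_cart)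
  from this[of undefined] have lm: "l \<le> m" by linarith
  have Q: "?Q \<in> cubes" and R: "?R \<in> cubes" using l lm by (auto intro!: cubesI)
  have [measurable]: "?Q \<in> sets lebesgue" by simp
  have R_eq: "emeasure lebesgue ?R = ennreal ((m / l) ^ CARD('n)) * emeasure lebesgue ?Q"
    unfolding emeasure_cube[OF less_imp_le[OF l]] emeasure_cube[OF order_trans[OF less_imp_le[OF l] lm]]
    using l lm by (simp add: ennreal_mult[symmetric] power_divide)
  let ?avg = "average ?R (\<lambda>x. ennreal (u x))"
  have "?avg * emeasure lebesgue ?Q = (\<integral>\<^sup>+x\<in>?Q. ?avg \<partial>lebesgue)"
    by (simp add: nn_integral_cmult_indicator)
  also have "\<dots> \<le> (\<integral>\<^sup>+x\<in>?Q. (ennreal A * ennreal (u x)) \<partial>lebesgue)"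
    using A(2)[OF R] sub by (intro nn_integral_mono_AE) (auto split: split_indicator elim!: eventually_mono)
  also have "\<dots> = ennreal A * emeasure ?M ?Q"
    unfolding M[OF Q] by (simp add: nn_integral_cmult mult.assoc)
  finally have *: "?avg * emeasure lebesgue ?Q \<le> ennreal A * emeasure ?M ?Q" .
  have "emeasure ?M ?R = ennreal ((m / l) ^ CARD('n)) * (?avg * emeasure lebesgue ?Q)"
    unfolding M[OF R] nn_integral_cube_eq_average[OF R] R_eq by (simp add: mult_ac)
  also have "\<dots> \<le> ennreal ((10 * real CARD('n)) ^ CARD('n)) * (ennreal A * emeasure ?M ?Q)"
    using m l lm by (intro mult_mono[OF _ *] ennreal_leI power_mono) (auto simp: field_simps)
  also have "\<dots> = ennreal (A * (10 * real CARD('n)) ^ CARD('n)) * emeasure ?M ?Q"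
    using A(1) by (simp add: ennreal_mult mult_ac)
  finally show "emeasure ?M ?R \<le> ennreal (A * (10 * real CARD('n)) ^ CARD('n)) * emeasure ?M ?Q" .
qed

section \<open>Luxemburg averages and powers\<close>

text \<open>Half of the admissible value \<open>1\<close> is spent on the constant \<open>1/2\<close>, the other half on the power.
  The limit \<open>y \<down> G\<close> covers \<open>G = 0\<close>, for which the bound itself is not an admissible parameter.\<close>

lemma luxemburg_le_power_average:
  fixes g :: "real ^ 'n \<Rightarrow> real"
  assumes Q: "Q \<in> cubes" and [measurable]: "g \<in> borel_measurable lebesgue"
    and pos: "0 < t" "0 < \<sigma>" "0 < K"
    and \<phi>: "\<And>\<tau>. 0 \<le> \<tau> \<Longrightarrow> \<phi> \<tau> \<le> ennreal (1 / 2 + K * \<tau> powr \<sigma>)"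
    and G: "average Q (\<lambda>x. ennreal ((\<bar>g x\<bar> / t) powr \<sigma>)) \<le> ennreal G" "0 \<le> G"
  shows "luxemburg \<phi> Q g \<le> ennreal (t * (2 * K * G) powr (1 / \<sigma>))"
proof (rule le_ennreal_by_right_limit[where h = "\<lambda>y. t * (2 * K * y) powr (1 / \<sigma>)"])
  fix y assume y: "G < y"
  define c where "c = t * (2 * K * y) powr (1 / \<sigma>)"
  have c: "0 < c" using y G(2) pos by (simp add: c_def)
  have scale: "K * (\<bar>g x\<bar> / c) powr \<sigma> = 1 / (2 * y) * (\<bar>g x\<bar> / t) powr \<sigma>" for x
  proof -
    have "\<bar>g x\<bar> / c = (\<bar>g x\<bar> / t) / (2 * K * y) powr (1 / \<sigma>)" by (simp add: c_def)
    then have "(\<bar>g x\<bar> / c) powr \<sigma> = ((\<bar>g x\<bar> / t) / (2 * K * y) powr (1 / \<sigma>)) powr \<sigma>" by (simp only:)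
    also have "\<dots> = (\<bar>g x\<bar> / t) powr \<sigma> / (2 * K * y)"
      using y G(2) pos by (subst powr_divide) (auto simp: powr_powr)
    finally show ?thesis using pos by simp
  qed
  have "average Q (\<lambda>x. \<phi> (\<bar>g x\<bar> / c)) \<le> average Q (\<lambda>x. ennreal (1 / 2) + ennreal (1 / (2 * y)) * ennreal ((\<bar>g x\<bar> / t) powr \<sigma>))"
  proof (intro average_mono_AE AE_I2 impI)
    fix x
    have "\<phi> (\<bar>g x\<bar> / c) \<le> ennreal (1 / 2 + K * (\<bar>g x\<bar> / c) powr \<sigma>)" using c by (intro \<phi>) auto
    also have "\<dots> = ennreal (1 / 2) + ennreal (1 / (2 * y)) * ennreal ((\<bar>g x\<bar> / t) powr \<sigma>)"
      using y G(2) unfolding scale by (subst ennreal_plus) (auto simp: ennreal_mult[symmetric])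
    finally show "\<phi> (\<bar>g x\<bar> / c) \<le> ennreal (1 / 2) + ennreal (1 / (2 * y)) * ennreal ((\<bar>g x\<bar> / t) powr \<sigma>)" .
  qed
  also have "\<dots> = ennreal (1 / 2) + ennreal (1 / (2 * y)) * average Q (\<lambda>x. ennreal ((\<bar>g x\<bar> / t) powr \<sigma>))"
    using Q by (simp add: average_const_add average_cmult)
  also have "\<dots> \<le> ennreal (1 / 2) + ennreal (1 / (2 * y)) * ennreal y"
    using G y by (intro add_left_mono mult_left_mono) (auto intro: order_trans ennreal_leI)
  also have "\<dots> = ennreal (1 / 2 + 1 / (2 * y) * y)"
    using G(2) y by (subst ennreal_plus) (auto simp: ennreal_mult[symmetric])
  also have "\<dots> = 1" using G(2) y by simp
  finally have "average Q (\<lambda>x. \<phi> (\<bar>g x\<bar> / c)) \<le> 1" .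
  then show "luxemburg \<phi> Q g \<le> ennreal (t * (2 * K * y) powr (1 / \<sigma>))"
    unfolding luxemburg_def c_def[symmetric] using c by (intro Inf_lower) auto
next
  show "((\<lambda>y. t * (2 * K * y) powr (1 / \<sigma>)) \<longlongrightarrow> t * (2 * K * G) powr (1 / \<sigma>)) (at_right G)"
    using pos G(2) eventually_at_right_less[of G]
    by (intro tendsto_intros tendsto_powr' disjI2 conjI) (auto elim!: eventually_mono)
qed

lemma average_powr_le_luxemburg:
  fixes v :: "real ^ 'n \<Rightarrow> real"
  assumes Q: "Q \<in> cubes" and [measurable]: "v \<in> borel_measurable lebesgue"
    and v: "AE x in lebesgue. 0 < v x" and s: "0 < s"
    and \<phi>: "\<And>\<tau>. 0 \<le> \<tau> \<Longrightarrow> ennreal (\<tau> powr s) \<le> \<phi> \<tau>"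
    and m: "luxemburg \<phi> Q v \<le> ennreal m" "0 \<le> m"
  shows "average Q (\<lambda>x. ennreal (v x powr s)) \<le> ennreal (m powr s)"
proof (rule le_ennreal_by_right_limit[where h = "\<lambda>y. y powr s"])
  fix y assume y: "m < y"
  then have "luxemburg \<phi> Q v < ennreal y" using m by (simp add: ennreal_lessI order.strict_trans1)
  then obtain c where c: "0 < c" "ennreal c < ennreal y" "average Q (\<lambda>x. \<phi> (\<bar>v x\<bar> / c)) \<le> 1"
    unfolding luxemburg_def Inf_less_iff by auto
  have cy: "c \<le> y" using c by (simp add: ennreal_less_iff)
  have "average Q (\<lambda>x. ennreal (v x powr s)) \<le> average Q (\<lambda>x. ennreal (c powr s) * ennreal ((\<bar>v x\<bar> / c) powr s))"
  proof (rule average_mono_AE, use v in eventually_elim)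
    case (elim x)
    then show ?case using c(1) by (simp add: ennreal_mult[symmetric] powr_divide)
  qed
  also have "\<dots> = ennreal (c powr s) * average Q (\<lambda>x. ennreal ((\<bar>v x\<bar> / c) powr s))"
    using Q by (simp add: average_cmult)
  also have "\<dots> \<le> ennreal (c powr s) * average Q (\<lambda>x. \<phi> (\<bar>v x\<bar> / c))"
    using \<phi> c(1) by (intro mult_left_mono average_mono_AE AE_I2) auto
  also have "\<dots> \<le> ennreal (c powr s) * 1" using c(3) by (intro mult_left_mono) auto
  also have "\<dots> \<le> ennreal (y powr s)" using cy c(1) s by (simp add: ennreal_leI powr_mono2)
  finally show "average Q (\<lambda>x. ennreal (v x powr s)) \<le> ennreal (y powr s)" .
next
  show "((\<lambda>y. y powr s) \<longlongrightarrow> m powr s) (at_right m)"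
    using s m(2) eventually_at_right_less[of m]
    by (intro tendsto_powr' tendsto_intros disjI2 conjI) (auto elim!: eventually_mono)
qed

text \<open>A power larger than \<open>r\<close> absorbs the logarithm for large \<open>\<tau>\<close>. For small \<open>\<tau>\<close> it cannot dominate
  \<open>\<tau>\<^sup>r\<close>, hence the additive constant \<open>1/2\<close>.\<close>

lemma power_log_le_power:
  fixes r \<delta> \<sigma> :: real
  assumes "0 < r" "r < \<sigma>" "0 \<le> \<delta>"
  obtains K where "0 < K" "\<And>\<tau>. 0 \<le> \<tau> \<Longrightarrow> power_log r \<delta> \<tau> \<le> ennreal (1 / 2 + K * \<tau> powr \<sigma>)"
proof
  define \<epsilon> where "\<epsilon> = (\<sigma> - r) / (\<delta> + 1)"
  have \<epsilon>: "0 < \<epsilon>" "\<epsilon> * \<delta> \<le> \<sigma> - r" using assms by (auto simp: \<epsilon>_def field_simps)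
  define K0 where "K0 = (1 + 1 / \<epsilon>) powr \<delta>"
  define K1 where "K1 = 2 powr (\<sigma> / r)"
  have K: "0 \<le> K0" "0 < K1" by (auto simp: K0_def K1_def)
  then show "0 < K0 + K1" by simp
  fix \<tau> :: real assume \<tau>: "0 \<le> \<tau>"
  have "\<tau> powr r * (1 + max 0 (ln \<tau>)) powr \<delta> \<le> 1 / 2 + (K0 + K1) * \<tau> powr \<sigma>"
  proof (cases "1 \<le> \<tau>")
    case True
    have "ln \<tau> \<le> \<tau> powr \<epsilon> / \<epsilon>" using True \<epsilon> by (intro ln_powr_bound) auto
    moreover have one: "1 \<le> \<tau> powr \<epsilon>" using True \<epsilon> by (intro ge_one_powr_ge_zero) auto
    ultimately have "1 + max 0 (ln \<tau>) \<le> (1 + 1 / \<epsilon>) * \<tau> powr \<epsilon>" using True by (simp add: algebra_simps)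
    then have "(1 + max 0 (ln \<tau>)) powr \<delta> \<le> ((1 + 1 / \<epsilon>) * \<tau> powr \<epsilon>) powr \<delta>"
      using assms by (intro powr_mono2) auto
    also have "\<dots> = K0 * \<tau> powr (\<epsilon> * \<delta>)" using \<epsilon> by (simp add: powr_mult powr_powr K0_def)
    also have "\<dots> \<le> K0 * \<tau> powr (\<sigma> - r)" using True \<epsilon> K by (intro mult_left_mono powr_mono) auto
    finally have "\<tau> powr r * (1 + max 0 (ln \<tau>)) powr \<delta> \<le> \<tau> powr r * (K0 * \<tau> powr (\<sigma> - r))"
      by (intro mult_left_mono) auto
    also have "\<dots> = K0 * \<tau> powr \<sigma>" by (simp add: powr_add[symmetric])
    also have "\<dots> \<le> 1 / 2 + (K0 + K1) * \<tau> powr \<sigma>" using K by (simp add: algebra_simps)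
    finally show ?thesis .
  next
    case False
    then have "max 0 (ln \<tau>) = 0" using \<tau> by (cases "\<tau> = 0") auto
    then have eq: "\<tau> powr r * (1 + max 0 (ln \<tau>)) powr \<delta> = \<tau> powr r" by simp
    show ?thesis
    proof (cases "\<tau> powr r \<le> 1 / 2")
      case True
      then show ?thesis unfolding eq using K by (simp add: add_increasing2)
    next
      case big: False
      have "\<tau> powr r \<le> 1" using False \<tau> assms powr_mono2[of r \<tau> 1] by simp
      also have "1 = K1 * (1 / 2) powr (\<sigma> / r)" by (simp add: K1_def powr_divide)
      also have "\<dots> \<le> K1 * (\<tau> powr r) powr (\<sigma> / r)"
        using big K assms by (intro mult_left_mono powr_mono2) auto
      also have "\<dots> = K1 * \<tau> powr \<sigma>" using assms by (simp add: powr_powr)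
      also have "\<dots> \<le> 1 / 2 + (K0 + K1) * \<tau> powr \<sigma>" using K by (simp add: algebra_simps)
      finally show ?thesis unfolding eq .
    qed
  qed
  then show "power_log r \<delta> \<tau> \<le> ennreal (1 / 2 + (K0 + K1) * \<tau> powr \<sigma>)"
    unfolding power_log_def by (rule ennreal_leI)
qed

lemma power_le_power_log:
  assumes "0 \<le> b"
  shows "ennreal (\<tau> powr a) \<le> power_log a b \<tau>"
proof -
  have "1 \<le> (1 + max 0 (ln \<tau>)) powr b" using assms by (intro ge_one_powr_ge_zero) auto
  then have "\<tau> powr a * 1 \<le> \<tau> powr a * (1 + max 0 (ln \<tau>)) powr b" by (intro mult_left_mono) auto
  then show ?thesis unfolding power_log_def by (intro ennreal_leI) simp
qed

section \<open>The estimate on a single cube\<close>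

text \<open>The exponents of the Hoelder inequality on a cube; \<open>i\<close> stands for \<open>1/r'\<close>. The integrand \<open>(|f| v / t)\<^sup>\<sigma>\<close> is split into the
  factors \<open>(k\<^sup>b u)\<^sup>\<theta>\<close> and \<open>(v\<^sup>s)\<^bsup>1 - \<theta>\<^esup>\<close>. Comparing powers of \<open>f\<close> forces \<open>\<theta> = \<sigma>/(p b)\<close>, comparing powers of \<open>v\<close> forces the
  value of \<open>1 - \<theta>\<close>, and \<open>X\<close> is the power of \<open>u\<close> that is left over.\<close>

locale hoelder_exponents =
  fixes p q s i \<sigma> b \<theta> X :: real
  assumes p_pos: "0 < p" and p_less_q: "p < q" and s_pos: "0 < s"
    and s_eq: "s / q = 1 / p + i"
    and b: "0 < b" "b < 1" and \<sigma>_pos: "0 < \<sigma>"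
    and \<theta>_eq: "\<theta> = \<sigma> / (p * b)" and \<theta>_less: "\<theta> < 1"
    and \<theta>_compl: "1 - \<theta> = \<sigma> * (1 / s - 1 / q)"
    and X_eq: "X = \<sigma> / p - \<theta> - \<sigma> / q"

begin

lemma q_pos: "0 < q" using p_pos p_less_q by simp

lemma theta_pos: "0 < \<theta>" using \<sigma>_pos b p_pos by (simp add: \<theta>_eq)

text \<open>Negativity of \<open>X\<close> amounts to \<open>b < 1\<close>. It is what lets a lower bound for \<open>u\<close> on the cube
  control the factor \<open>u\<^sup>X\<close>.\<close>

lemma X_neg: "X < 0"
proof -
  have "p * b \<le> p" using p_pos b by simp
  then have "\<sigma> / p \<le> \<theta>" unfolding \<theta>_eq using \<sigma>_pos b p_pos by (intro divide_left_mono) auto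
  moreover have "0 < \<sigma> / q" using \<sigma>_pos q_pos by simp
  ultimately show ?thesis by (simp add: X_eq)
qed

lemma v_exponent: "s * (1 - \<theta>) = \<sigma> * (1 - 1 / p - i)"
proof -
  have "s * (1 / s - 1 / q) = 1 - s / q" using s_pos by (simp add: right_diff_distrib)
  then show ?thesis unfolding \<theta>_compl using s_eq by (simp add: mult.left_commute)
qed

lemma integrand_factorization:
  assumes "0 < u" "0 < v" "0 < t"
  shows "(\<bar>f * v\<bar> / t) powr \<sigma> = u powr X *
    ((((\<bar>f\<bar> / t) powr p * u powr (p / q - 1) * v powr (1 + p * i)) powr b * u) powr \<theta> * (v powr s) powr (1 - \<theta>))"
proof (cases "f = 0")
  case False
  define y where "y = \<bar>f\<bar> / t"
  have y: "0 < y" using False assms by (simp add: y_def)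
  have b\<theta>: "b * \<theta> = \<sigma> / p" using b p_pos by (simp add: \<theta>_eq)
  have "((y powr p * u powr (p / q - 1) * v powr (1 + p * i)) powr b * u) powr \<theta>
    = y powr (p * (b * \<theta>)) * u powr ((p / q - 1) * (b * \<theta>)) * v powr ((1 + p * i) * (b * \<theta>)) * u powr \<theta>"
    using y assms by (simp add: powr_mult powr_powr mult.assoc)
  also have "\<dots> = y powr \<sigma> * u powr ((p / q - 1) * (\<sigma> / p)) * v powr ((1 + p * i) * (\<sigma> / p)) * u powr \<theta>"
    unfolding b\<theta> using p_pos by simp
  finally have "u powr X * (((y powr p * u powr (p / q - 1) * v powr (1 + p * i)) powr b * u) powr \<theta> * (v powr s) powr (1 - \<theta>))
    = y powr \<sigma> * (u powr X * u powr ((p / q - 1) * (\<sigma> / p)) * u powr \<theta>) * (v powr ((1 + p * i) * (\<sigma> / p)) * v powr (s * (1 - \<theta>)))"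
    by (simp add: powr_powr)
  also have "\<dots> = y powr \<sigma> * u powr (X + (p / q - 1) * (\<sigma> / p) + \<theta>) * v powr ((1 + p * i) * (\<sigma> / p) + s * (1 - \<theta>))"
    by (simp only: powr_add)
  also have "X + (p / q - 1) * (\<sigma> / p) + \<theta> = 0" using p_pos by (simp add: X_eq field_simps)
  also have "(1 + p * i) * (\<sigma> / p) + s * (1 - \<theta>) = \<sigma>" unfolding v_exponent using p_pos by (simp add: field_simps)
  also have "y powr \<sigma> * u powr 0 * v powr \<sigma> = (\<bar>f * v\<bar> / t) powr \<sigma>"
    using assms y by (simp add: y_def abs_mult powr_mult[symmetric])
  finally show ?thesis unfolding y_def by simp
qed (use p_pos in simp)

text \<open>As \<open>X < 0\<close>, the lower bound \<open>U / A \<le> u\<close> bounds \<open>u\<^sup>X\<close> by a constant on the cube, and Hoelder's inequality applies to the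
  two remaining factors.\<close>

lemma average_power_le:
  fixes u v f :: "real ^ 'n \<Rightarrow> real"
  assumes Q: "Q \<in> cubes" and [measurable]: "u \<in> borel_measurable lebesgue" "v \<in> borel_measurable lebesgue" "f \<in> borel_measurable lebesgue"
    and pos: "AE x in lebesgue. 0 < u x" "AE x in lebesgue. 0 < v x" and t: "0 < t"
    and k: "k = (\<lambda>x. (\<bar>f x\<bar> / t) powr p * u x powr (p / q - 1) * v x powr (1 + p * i))"
    and U: "0 < U" "0 < A" "AE x in lebesgue. x \<in> Q \<longrightarrow> U \<le> A * u x"
    and N: "average Q (\<lambda>x. ennreal (k x powr b * u x)) \<le> ennreal (U * N)" "0 \<le> N"
    and W: "average Q (\<lambda>x. ennreal (v x powr s)) \<le> ennreal W" "0 \<le> W"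
  shows "average Q (\<lambda>x. ennreal ((\<bar>f x * v x\<bar> / t) powr \<sigma>)) \<le> ennreal ((U / A) powr X * ((U * N) powr \<theta> * W powr (1 - \<theta>)))"
proof -
  have [measurable]: "k \<in> borel_measurable lebesgue" unfolding k by measurable
  let ?a = "\<lambda>x. k x powr b * \<bar>u x\<bar>" and ?w = "\<lambda>x. v x powr s"
  \<comment> \<open>The absolute value in \<open>?a\<close> only serves to make it nonnegative on the null set where \<open>u\<close> is not positive.\<close>
  have "average Q (\<lambda>x. ennreal (?a x)) \<le> average Q (\<lambda>x. ennreal (k x powr b * u x))"
    by (rule average_mono_AE, use pos(1) in eventually_elim) auto
  with N have a: "average Q (\<lambda>x. ennreal (?a x)) \<le> ennreal (U * N)" by simp
  have "average Q (\<lambda>x. ennreal ((\<bar>f x * v x\<bar> / t) powr \<sigma>))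
      \<le> average Q (\<lambda>x. ennreal ((U / A) powr X) * ennreal (?a x powr \<theta> * ?w x powr (1 - \<theta>)))"
  proof (rule average_mono_AE, use pos U(3) in eventually_elim)
    case (elim x)
    show ?case
    proof
      assume "x \<in> Q"
      then have "U / A \<le> u x" using elim U by (simp add: field_simps)
      then have X: "u x powr X \<le> (U / A) powr X" using X_neg U by (intro powr_mono2') auto
      have "(\<bar>f x * v x\<bar> / t) powr \<sigma> = u x powr X * (?a x powr \<theta> * ?w x powr (1 - \<theta>))"
        using integrand_factorization[OF elim(1,2) t, of "f x"] elim by (simp add: k)
      also have "\<dots> \<le> (U / A) powr X * (?a x powr \<theta> * ?w x powr (1 - \<theta>))" using X by (intro mult_right_mono) auto
      finally show "ennreal ((\<bar>f x * v x\<bar> / t) powr \<sigma>) \<le> ennreal ((U / A) powr X) * ennreal (?a x powr \<theta> * ?w x powr (1 - \<theta>))"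
        by (subst ennreal_mult[symmetric]) (auto intro: ennreal_leI)
    qed
  qed
  also have "\<dots> = ennreal ((U / A) powr X) * average Q (\<lambda>x. ennreal (?a x powr \<theta> * ?w x powr (1 - \<theta>)))"
    using Q by (simp add: average_cmult)
  also have "average Q (\<lambda>x. ennreal (?a x powr \<theta> * ?w x powr (1 - \<theta>))) \<le> ennreal ((U * N) powr \<theta> * W powr (1 - \<theta>))"
    using a W N U theta_pos \<theta>_less Q
    by (subst average_eq_uniform_measure, simp, measurable)
       (intro nn_integral_powr_product_le, auto simp: average_eq_uniform_measure)
  finally show ?thesis by (simp add: ennreal_mult mult_left_mono)
qed

text \<open>The powers of the \<open>u\<close>-average \<open>U\<close> combine to \<open>1/p - 1/q = \<gamma>/n\<close>, exactly the power of \<open>|Q|\<close> in the fractional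
  maximal operator, so that together they make up \<open>\<mu>(Q)\<^bsup>\<gamma>/n\<^esup>\<close>.\<close>

lemma fractional_term_le:
  fixes u v f :: "real ^ 'n \<Rightarrow> real"
  assumes Q: "Q \<in> cubes" and [measurable]: "u \<in> borel_measurable lebesgue" "v \<in> borel_measurable lebesgue" "f \<in> borel_measurable lebesgue"
    and pos: "AE x in lebesgue. 0 < u x" "AE x in lebesgue. 0 < v x" and t: "0 < t"
    and k: "k = (\<lambda>x. (\<bar>f x\<bar> / t) powr p * u x powr (p / q - 1) * v x powr (1 + p * i))"
    and U: "0 < U" "0 < A" "AE x in lebesgue. x \<in> Q \<longrightarrow> U \<le> A * u x"
    and N: "average Q (\<lambda>x. ennreal (k x powr b * u x)) \<le> ennreal (U * N)" "0 \<le> N"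
    and W: "average Q (\<lambda>x. ennreal (v x powr s)) \<le> ennreal W" "0 \<le> W"
    and K: "0 < K" "\<And>\<tau>. 0 \<le> \<tau> \<Longrightarrow> \<phi> \<tau> \<le> ennreal (1 / 2 + K * \<tau> powr \<sigma>)"
  shows "luxemburg \<phi> Q (\<lambda>x. f x * v x)
    \<le> ennreal (t * ((2 * K * (1 / A) powr X) powr (1 / \<sigma>) * U powr (1 / p - 1 / q) * N powr (1 / (p * b)) * W powr (1 / s - 1 / q)))"
proof -
  let ?G = "(U / A) powr X * ((U * N) powr \<theta> * W powr (1 - \<theta>))"
  have e1: "X + \<theta> = \<sigma> * (1 / p - 1 / q)" by (simp add: X_eq algebra_simps)
  have e2: "\<theta> / \<sigma> = 1 / (p * b)" using \<sigma>_pos by (simp add: \<theta>_eq)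
  have e3: "(1 - \<theta>) / \<sigma> = 1 / s - 1 / q" using \<sigma>_pos by (simp add: \<theta>_compl)
  have "(U / A) powr X * (U * N) powr \<theta> = (1 / A) powr X * (U powr X * U powr \<theta>) * N powr \<theta>"
    using U N by (simp add: powr_divide powr_mult)
  also have "\<dots> = (1 / A) powr X * U powr (\<sigma> * (1 / p - 1 / q)) * N powr \<theta>"
    by (simp only: powr_add[symmetric] e1)
  finally have scaled: "2 * K * ?G = (2 * K * (1 / A) powr X) * U powr (\<sigma> * (1 / p - 1 / q)) * N powr \<theta> * W powr (1 - \<theta>)"
    by (simp add: mult.assoc[symmetric])
  have G: "(2 * K * ?G) powr (1 / \<sigma>) = (2 * K * (1 / A) powr X) powr (1 / \<sigma>) * U powr (1 / p - 1 / q) * N powr (1 / (p * b)) * W powr (1 / s - 1 / q)"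
    unfolding scaled using K(1) \<sigma>_pos U N W by (simp add: powr_mult powr_powr e2 e3)
  show ?thesis
    unfolding G[symmetric] using K \<sigma>_pos t Q N U W
    by (intro luxemburg_le_power_average average_power_le[OF Q _ _ _ pos t k U N W]) auto
qed

text \<open>The numerical core. The hypothesis on \<open>m\<close> is the level set condition on a cube with \<open>\<mu>(Q) = V\<close>. Since
  \<open>s (1/s - 1/q) = 1 - s/q\<close>, dividing by the power of \<open>m\<close> on the right leaves \<open>m\<^bsup>s/q\<^esup>\<close> on the left.\<close>

lemma power_of_height_le:
  assumes "0 < V" "0 \<le> m" "0 \<le> N" "0 \<le> H" "0 \<le> c"
    and level: "m < c * V powr (1 / p - 1 / q) * N powr (1 / (p * b)) * (m powr s) powr (1 / s - 1 / q)"
    and N: "N powr (1 / b) \<le> H / V"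
  shows "m powr s \<le> c powr q * H powr (q / p - 1) * N powr (1 / b)"
proof -
  have gq: "(1 / p - 1 / q) * q = q / p - 1" using q_pos by (simp add: left_diff_distrib)
  have split: "(c * V powr (1 / p - 1 / q) * N powr (1 / (p * b))) powr q
    = c powr q * V powr (q / p - 1) * (N powr (1 / b)) powr (q / p)"
    using assms(5) q_pos by (simp add: powr_mult powr_powr gq mult.commute[of b p])
  have m: "0 < m" using assms(2) level by (cases "m = 0") auto
  have N0: "0 < N" using assms(2,3) level by (cases "N = 0") auto
  have "s * (1 / s - 1 / q) = 1 - s / q" using s_pos by (simp add: right_diff_distrib)
  then have "(m powr s) powr (1 / s - 1 / q) = m powr (1 - s / q)" by (simp only: powr_powr)
  also have "\<dots> = m / m powr (s / q)" using m by (simp add: powr_diff)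
  finally have "(m powr s) powr (1 / s - 1 / q) = m / m powr (s / q)" .
  with level have "m < c * V powr (1 / p - 1 / q) * N powr (1 / (p * b)) * (m / m powr (s / q))" by (simp only:)
  then have "m powr (s / q) * m < (c * V powr (1 / p - 1 / q) * N powr (1 / (p * b))) * m"
    using m by (simp add: pos_less_divide_eq mult.commute)
  then have "m powr (s / q) < c * V powr (1 / p - 1 / q) * N powr (1 / (p * b))"
    using m by (simp only: mult_less_cancel_right_pos)
  then have "(m powr (s / q)) powr q \<le> (c * V powr (1 / p - 1 / q) * N powr (1 / (p * b))) powr q"
    using q_pos by (intro powr_mono2) auto
  also have "(m powr (s / q)) powr q = m powr s" using q_pos by (simp add: powr_powr)
  also note split
  \<comment> \<open>Hedberg's device: the excess power \<open>q/p - 1\<close> goes together with the same power of \<open>V\<close>, where \<open>N\<close> is bounded by \<open>H\<close>.\<close>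
  also have "(N powr (1 / b)) powr (q / p) = (N powr (1 / b)) powr (q / p - 1) * N powr (1 / b)"
    using N0 by (simp add: powr_diff)
  also have "c powr q * V powr (q / p - 1) * ((N powr (1 / b)) powr (q / p - 1) * N powr (1 / b))
    = c powr q * (V * N powr (1 / b)) powr (q / p - 1) * N powr (1 / b)"
    using assms by (simp add: powr_mult)
  also have "\<dots> \<le> c powr q * H powr (q / p - 1) * N powr (1 / b)"
  proof (intro mult_right_mono mult_left_mono powr_mono2)
    show "V * N powr (1 / b) \<le> H" using N assms(1) by (simp add: field_simps)
    show "0 \<le> q / p - 1" using p_pos p_less_q by simp
  qed (use assms in auto)
  finally show ?thesis .
qed

end

text \<open>Put \<open>e = 1/\<sigma>\<close> and \<open>\<kappa> = 1/s - 1/q = (1/r - 1/p)/s\<close>. The condition \<open>b < 1\<close> reads \<open>1/p + \<kappa> < e\<close>, and the condition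
  \<open>r < \<sigma>\<close> reads \<open>e < 1/r\<close>. Both can be met because \<open>s > 1\<close>; this is where \<open>r < p < q\<close> is used.\<close>

lemma hoelder_exponents_exist:
  fixes p q r s :: real
  assumes "1 \<le> r" "r < p" "p < q" and s: "s = q * (1 / p + (1 - 1 / r))"
  obtains \<sigma> b \<theta> X where "r < \<sigma>" "hoelder_exponents p q s (1 - 1 / r) \<sigma> b \<theta> X"
proof -
  define \<kappa> where "\<kappa> = 1 / s - 1 / q"
  have pq: "0 < p" "0 < q" "0 < r" using assms by auto
  have r1: "0 \<le> 1 - 1 / r" using assms by simp
  have "1 < q / p" using assms pq by simp
  also have "q / p \<le> s" unfolding s using pq r1 by (simp add: distrib_left)
  finally have s1: "1 < s" .
  have d: "0 < 1 / r - 1 / p" using assms pq by (simp add: frac_less2)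
  have sq: "s / q = 1 / p + (1 - 1 / r)" using pq by (simp add: s)
  have "s * \<kappa> = 1 - s / q" unfolding \<kappa>_def using s1 by (simp add: right_diff_distrib)
  then have s\<kappa>: "s * \<kappa> = 1 / r - 1 / p" using sq by simp
  then have \<kappa>: "0 < \<kappa>" using d s1 by (metis less_trans zero_less_mult_pos zero_less_one)
  then have "\<kappa> < s * \<kappa>" using s1 by simp
  then have "1 / p + \<kappa> < 1 / r" using s\<kappa> by simp
  then obtain e where e: "1 / p + \<kappa> < e" "e < 1 / r" using dense by blast
  have e0: "0 < e" using e \<kappa> pq by (smt (verit) divide_pos_pos)
  have pe: "1 < p * (e - \<kappa>)"
  proof -
    have "1 / p < e - \<kappa>" using e by simp
    then have "p * (1 / p) < p * (e - \<kappa>)" using pq by (intro mult_strict_left_mono)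
    then show ?thesis using pq by simp
  qed
  define b where "b = 1 / (p * (e - \<kappa>))"
  show thesis
  proof (rule that)
    show "r < 1 / e" using e(2) e0 pq by (simp add: field_simps)
    have \<theta>: "1 / e / (p * b) = 1 - (1 / e) * \<kappa>"
      using pq pe e0 by (simp add: b_def field_simps)
    show "hoelder_exponents p q s (1 - 1 / r) (1 / e) b (1 / e / (p * b)) (1 / e / p - 1 / e / (p * b) - 1 / e / q)"
    proof
      show "0 < b" "b < 1" using pe by (auto simp: b_def)
      show "1 / e / (p * b) < 1" unfolding \<theta> using e0 \<kappa> by simp
      show "1 - 1 / e / (p * b) = 1 / e * (1 / s - 1 / q)" unfolding \<theta> \<kappa>_def by simp
    qed (use pq assms s1 sq e0 in auto)
  qed
qed

section \<open>The level set and the mixed inequality\<close>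

text \<open>The cube \<open>Q\<close> is one that witnesses the level set condition at \<open>x\<close>. All cubes through \<open>x\<close> have a
  \<open>v\<^sup>s\<close>-average of at most \<open>m\<^sup>s\<close>, where \<open>m\<close> is the maximal function of \<open>v\<close> at \<open>x\<close>: for \<open>Q\<close> itself this feeds the Hoelder estimate,
  and for the other cubes it bounds the supremum on the left.\<close>

theorem level_set_pointwise:
  fixes u v f :: "real ^ 'n \<Rightarrow> real"
  assumes exps: "hoelder_exponents p q s i \<sigma> b \<theta> X"
    and growth: "cube_growth (density lebesgue (\<lambda>x. ennreal (u x))) D"
    and [measurable]: "u \<in> borel_measurable lebesgue" "v \<in> borel_measurable lebesgue" "f \<in> borel_measurable lebesgue"
    and pos: "AE x in lebesgue. 0 < u x" "AE x in lebesgue. 0 < v x" and t: "0 < t"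
    and A: "0 < A"
      "\<And>Q. Q \<in> cubes \<Longrightarrow> AE x in lebesgue. x \<in> Q \<longrightarrow> average Q (\<lambda>x. ennreal (u x)) \<le> ennreal A * ennreal (u x)"
    and k: "k = (\<lambda>x. (\<bar>f x\<bar> / t) powr p * u x powr (p / q - 1) * v x powr (1 + p * i))"
    and H: "(\<integral>\<^sup>+x. ennreal (k x) \<partial>density lebesgue (\<lambda>x. ennreal (u x))) = ennreal H" "0 \<le> H"
    and \<phi>: "0 < K" "\<And>\<tau>. 0 \<le> \<tau> \<Longrightarrow> \<phi> \<tau> \<le> ennreal (1 / 2 + K * \<tau> powr \<sigma>)"
    and \<eta>: "\<And>\<tau>. 0 \<le> \<tau> \<Longrightarrow> ennreal (\<tau> powr s) \<le> \<eta> \<tau>"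
    and \<gamma>: "\<gamma> / real CARD('n) = 1 / p - 1 / q"
    and c: "c = (2 * K * (1 / A) powr X) powr (1 / \<sigma>)"
    and x: "x \<in> quotient_level_set \<gamma> \<phi> \<eta> (\<lambda>x. f x * v x) v t"
  obtains Q where "Q \<in> cubes" "x \<in> Q"
    "(SUP Q\<in>{Q \<in> cubes. x \<in> Q}. average Q (\<lambda>x. ennreal (v x powr s)))
      \<le> ennreal (c powr q * H powr (q / p - 1)) *
        epowr ((\<integral>\<^sup>+y\<in>Q. ennreal (k y powr b) \<partial>density lebesgue (\<lambda>x. ennreal (u x))) /
          emeasure (density lebesgue (\<lambda>x. ennreal (u x))) Q) (1 / b)"
proof -
  interpret hoelder_exponents p q s i \<sigma> b \<theta> X by fact
  let ?M = "density lebesgue (\<lambda>x. ennreal (u x))"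
  interpret cube_growth ?M D by fact
  have [measurable]: "k \<in> borel_measurable lebesgue" unfolding k by measurable
  have k0: "0 \<le> k x" for x unfolding k by simp
  from x have lt: "ennreal t < frac_maximal \<gamma> \<phi> (\<lambda>x. f x * v x) x / maximal \<eta> v x"
    by (simp add: quotient_level_set_def)
  obtain m where m: "0 \<le> m" "maximal \<eta> v x = ennreal m"
    using mult_less_if_less_divide_ennreal(1)[OF lt] by (cases "maximal \<eta> v x") auto
  have "ennreal t * ennreal m < frac_maximal \<gamma> \<phi> (\<lambda>x. f x * v x) x"
    using mult_less_if_less_divide_ennreal(2)[OF lt] m by simp
  then obtain Q where Q: "Q \<in> cubes" "x \<in> Q"
    and Qlt: "ennreal t * ennreal m < ennreal (measure lebesgue Q powr (\<gamma> / real CARD('n))) * luxemburg \<phi> Q (\<lambda>x. f x * v x)"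
    unfolding frac_maximal_def by (auto simp: less_SUP_iff)
  have avg_w: "average R (\<lambda>x. ennreal (v x powr s)) \<le> ennreal (m powr s)" if R: "R \<in> cubes" "x \<in> R" for R
  proof (rule average_powr_le_luxemburg[OF R(1)])
    have "luxemburg \<eta> R v \<le> maximal \<eta> v x" unfolding maximal_def using R by (intro SUP_upper) auto
    then show "luxemburg \<eta> R v \<le> ennreal m" using m by simp
  qed (use pos s_pos \<eta> m in auto)
  have Qs [measurable]: "Q \<in> sets lebesgue" using Q(1) by (rule cube_sets)
  define L where "L = measure lebesgue Q"
  have L: "0 < L" "emeasure lebesgue Q = ennreal L" using cube_emeasure_pos_finite[OF Q(1)] by (auto simp: L_def)
  define V where "V = measure ?M Q"
  have eV: "emeasure ?M Q = ennreal V" unfolding V_def using cube_finite[OF Q(1)] by (simp add: emeasure_eq_ennreal_measure less_top)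
  have V: "0 < V" using cube_pos[OF Q(1)] eV by simp
  define U where "U = V / L"
  have U: "0 < U" using V L by (simp add: U_def)
  have V_eq: "V = L * U" using L by (simp add: U_def)
  have avg_u: "average Q (\<lambda>x. ennreal (u x)) = ennreal U"
    using eV L V by (simp add: average_def U_def emeasure_density divide_ennreal)
  obtain N where N: "0 \<le> N" "(\<integral>\<^sup>+x\<in>Q. ennreal (k x powr b) \<partial>?M) = ennreal (V * N)" "N powr (1 / b) \<le> H / V"
    unfolding V_def by (rule average_powr_Jensen[OF _ k0 Q(1) H b]) auto
  have "(\<integral>\<^sup>+x\<in>Q. ennreal (k x powr b * u x) \<partial>lebesgue) = (\<integral>\<^sup>+x\<in>Q. ennreal (k x powr b) \<partial>?M)"
    by (subst nn_integral_density) (auto intro!: nn_integral_cong simp: ennreal_mult'[OF powr_ge_zero] ennreal_mult''[OF powr_ge_zero] mult_ac split: split_indicator)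
  then have avg_k: "average Q (\<lambda>x. ennreal (k x powr b * u x)) = ennreal (U * N)"
    using N L V by (simp add: average_def divide_ennreal U_def)
  have AU: "AE x in lebesgue. x \<in> Q \<longrightarrow> U \<le> A * u x"
    using A(2)[OF Q(1)] pos(1) unfolding avg_u
    by eventually_elim (use A(1) in \<open>auto simp: ennreal_mult[symmetric] ennreal_le_iff\<close>)
  \<comment> \<open>The Hoelder estimate with \<open>W = m\<^sup>s\<close> as the bound for the average of \<open>v\<^sup>s\<close>.\<close>
  have lux: "luxemburg \<phi> Q (\<lambda>x. f x * v x)
    \<le> ennreal (t * (c * U powr (1 / p - 1 / q) * N powr (1 / (p * b)) * (m powr s) powr (1 / s - 1 / q)))"
    unfolding c
    by (rule fractional_term_le[OF Q(1) _ _ _ pos t k U A(1) AU _ N(1) avg_w[OF Q] _ \<phi>]) (auto simp: avg_k)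
  have "ennreal t * ennreal m < ennreal (L powr (1 / p - 1 / q)) * luxemburg \<phi> Q (\<lambda>x. f x * v x)"
    using Qlt unfolding \<gamma> L_def .
  also have "\<dots> \<le> ennreal (L powr (1 / p - 1 / q)) * ennreal (t * (c * U powr (1 / p - 1 / q) * N powr (1 / (p * b)) * (m powr s) powr (1 / s - 1 / q)))"
    using lux by (rule mult_left_mono) simp
  also have "\<dots> = ennreal (t * (c * V powr (1 / p - 1 / q) * N powr (1 / (p * b)) * (m powr s) powr (1 / s - 1 / q)))"
    using L U by (subst ennreal_mult'[symmetric]) (auto simp: V_eq powr_mult mult_ac)
  finally have "t * m < t * (c * V powr (1 / p - 1 / q) * N powr (1 / (p * b)) * (m powr s) powr (1 / s - 1 / q))"
    using t m(1) by (simp only: ennreal_mult''[symmetric] ennreal_less_iff mult_nonneg_nonneg less_imp_le)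
  then have "m < c * V powr (1 / p - 1 / q) * N powr (1 / (p * b)) * (m powr s) powr (1 / s - 1 / q)"
    using t by simp
  then have "m powr s \<le> c powr q * H powr (q / p - 1) * N powr (1 / b)"
    using V m(1) N H(2) by (intro power_of_height_le[of V]) (auto simp: c)
  then have "ennreal (m powr s) \<le> ennreal (c powr q * H powr (q / p - 1)) * ennreal (N powr (1 / b))"
    by (subst ennreal_mult[symmetric]) (auto intro: ennreal_leI)
  also have "ennreal (N powr (1 / b)) = epowr ((\<integral>\<^sup>+y\<in>Q. ennreal (k y powr b) \<partial>?M) / emeasure ?M Q) (1 / b)"
    unfolding N(2) eV using V N(1) by (simp add: divide_ennreal epowr_ennreal)
  finally have le: "ennreal (m powr s) \<le> ennreal (c powr q * H powr (q / p - 1)) *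
    epowr ((\<integral>\<^sup>+y\<in>Q. ennreal (k y powr b) \<partial>?M) / emeasure ?M Q) (1 / b)" .
  have "(SUP Q\<in>{Q \<in> cubes. x \<in> Q}. average Q (\<lambda>x. ennreal (v x powr s))) \<le> ennreal (m powr s)"
    using avg_w by (intro SUP_least) auto
  then show thesis using that[OF Q] le by (meson order_trans)
qed

theorem theorem3:
  fixes u v :: "real ^ 'n \<Rightarrow> real"
    and r \<delta> \<gamma> p q r' n s :: real
    and \<Phi> \<eta> :: "real \<Rightarrow> ennreal"
  defines "n \<equiv> real CARD('n)"
    and "r' \<equiv> conj_exponent r"
    and "\<Phi> \<equiv> power_log r \<delta>"
    and "\<eta> \<equiv> power_log (q / p + q / r') (n * \<delta> / (n - r * \<gamma>))"
    and "s \<equiv> q * (1 / p + 1 / r')"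
  assumes "1 \<le> r" and "0 \<le> \<delta>"
    and "0 < \<gamma>" and "\<gamma> < n / r"
    and "r < p" and "p < n / \<gamma>"
    and "1 / q = 1 / p - \<gamma> / n"
    and "weight u" and "weight v"
    and "u \<in> A_one"
    and "(\<lambda>x. v x powr s) \<in> A_infinity"
  shows "\<exists>C>0. \<forall>f :: real ^ 'n \<Rightarrow> real. \<forall>t>0.
    f \<in> borel_measurable lebesgue \<longrightarrow> (\<lambda>x. f x * v x) \<in> L_loc \<Phi> \<longrightarrow>
    epowr (\<integral>\<^sup>+x\<in>quotient_level_set \<gamma> \<Phi> \<eta> (\<lambda>x. f x * v x) v t.
             ennreal (u x * v x powr s) \<partial>lebesgue) (1 / q)
    \<le> ennreal C * epowr (\<integral>\<^sup>+x. ennreal ((\<bar>f x\<bar> / t) powr p * u x powr (p / q)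
                                     * v x powr (1 + p / r')) \<partial>lebesgue) (1 / p)"
proof -
  note r = \<open>1 \<le> r\<close> \<open>r < p\<close>
  have n: "0 < n" by (simp add: n_def)
  have p: "0 < p" using r by simp
  have "\<gamma> / n < 1 / p" using \<open>p < n / \<gamma>\<close> \<open>0 < \<gamma>\<close> p n by (simp add: field_simps)
  then have "0 < 1 / q" using \<open>1 / q = 1 / p - \<gamma> / n\<close> by simp
  then have q: "0 < q" by simp
  have "0 < \<gamma> / n" using \<open>0 < \<gamma>\<close> n by simp
  then have "1 / q < 1 / p" using \<open>1 / q = 1 / p - \<gamma> / n\<close> by simp
  then have pq: "p < q" using p q by (simp add: field_simps)
  have r': "1 / r' = 1 - 1 / r" using conj_exponent_sum[OF \<open>1 \<le> r\<close>] unfolding r'_def by linarith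
  have s: "s = q * (1 / p + (1 - 1 / r))" unfolding s_def r' ..
  obtain \<sigma> b \<theta> X where \<sigma>: "r < \<sigma>" and exps: "hoelder_exponents p q s (1 - 1 / r) \<sigma> b \<theta> X"
    by (rule hoelder_exponents_exist[OF \<open>1 \<le> r\<close> \<open>r < p\<close> pq s])
  interpret E: hoelder_exponents p q s "1 - 1 / r" \<sigma> b \<theta> X by fact
  obtain K where K: "0 < K" "\<And>\<tau>. 0 \<le> \<tau> \<Longrightarrow> \<Phi> \<tau> \<le> ennreal (1 / 2 + K * \<tau> powr \<sigma>)"
    unfolding \<Phi>_def using power_log_le_power[of r \<sigma> \<delta>] \<open>1 \<le> r\<close> \<sigma> \<open>0 \<le> \<delta>\<close> by auto
  have "r * \<gamma> < n" using \<open>\<gamma> < n / r\<close> \<open>1 \<le> r\<close> by (simp add: field_simps)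
  then have "0 \<le> n * \<delta> / (n - r * \<gamma>)" using n \<open>0 \<le> \<delta>\<close> by simp
  moreover have "q / p + q / r' = s" unfolding s_def by (simp add: distrib_left)
  ultimately have \<eta>: "ennreal (\<tau> powr s) \<le> \<eta> \<tau>" for \<tau>
    unfolding \<eta>_def by (metis power_le_power_log)
  have \<gamma>: "\<gamma> / real CARD('n) = 1 / p - 1 / q" using \<open>1 / q = 1 / p - \<gamma> / n\<close> by (simp add: n_def)
  obtain A where A: "0 < A"
    "\<And>Q. Q \<in> cubes \<Longrightarrow> AE x in lebesgue. x \<in> Q \<longrightarrow> average Q (\<lambda>x. ennreal (u x)) \<le> ennreal A * ennreal (u x)"
    by (rule A_one_average_le[OF \<open>u \<in> A_one\<close>]) blast
  define D where "D = A * (10 * real CARD('n)) ^ CARD('n)"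
  let ?M = "density lebesgue (\<lambda>x. ennreal (u x))"
  have doubling: "cube_growth ?M D" unfolding D_def by (rule cube_growth_A_one[OF \<open>weight u\<close> A])
  interpret cube_growth ?M D by (rule doubling)
  have [measurable]: "u \<in> borel_measurable lebesgue" "v \<in> borel_measurable lebesgue"
    using \<open>weight u\<close> \<open>weight v\<close> by (auto simp: weight_def intro: locally_integrable_measurable)
  have pos: "AE x in lebesgue. 0 < u x" "AE x in lebesgue. 0 < v x"
    using \<open>weight u\<close> \<open>weight v\<close> by (auto simp: weight_def)
  obtain \<R> :: "(real ^ 'n) set set" where \<R>: "countable \<R>" "\<R> \<subseteq> cubes"
    "\<And>a l. 0 < l \<Longrightarrow> \<exists>b m. cbox b (b + vec m) \<in> \<R> \<and> cbox a (a + vec l) \<subseteq> cbox b (b + vec m) \<and> m \<le> 2 * l"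
    using countable_cube_family by blast
  define c where "c = (2 * K * (1 / A) powr X) powr (1 / \<sigma>)"
  have c: "0 < c" using K A by (simp add: c_def)
  define C1 where "C1 = c powr q * D powr (1 / b)"
  define C3 where "C3 = D * 2 powr (1 / b) * (1 / b) / (1 / b - 1)"
  define C2 where "C2 = C1 * C3"
  have b1: "1 < 1 / b" using E.b by simp
  have C1: "0 < C1" using c D_pos by (simp add: C1_def)
  have C3: "0 < C3" unfolding C3_def using D_pos b1 E.b by (intro divide_pos_pos mult_pos_pos) auto
  have C2: "0 < C2" unfolding C2_def by (rule mult_pos_pos[OF C1 C3])
  show ?thesis
  proof (intro exI[of _ "C2 powr (1 / q)"] conjI allI impI)
    show "0 < C2 powr (1 / q)" using C2 by simp
    fix f :: "real ^ 'n \<Rightarrow> real" and t :: real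
    assume t: "0 < t" and [measurable]: "f \<in> borel_measurable lebesgue"
    define k where "k = (\<lambda>x. (\<bar>f x\<bar> / t) powr p * u x powr (p / q - 1) * v x powr (1 + p * (1 - 1 / r)))"
    have [measurable]: "k \<in> borel_measurable lebesgue" unfolding k_def by measurable
    have k0: "0 \<le> k x" for x unfolding k_def by simp
    have pr': "p / r' = p * (1 - 1 / r)" unfolding r'[symmetric] by simp
    let ?h = "\<lambda>x. (\<bar>f x\<bar> / t) powr p * u x powr (p / q) * v x powr (1 + p / r')"
    let ?E = "quotient_level_set \<gamma> \<Phi> \<eta> (\<lambda>x. f x * v x) v t"
    have "(\<integral>\<^sup>+x. ennreal (k x) \<partial>?M) = (\<integral>\<^sup>+x. ennreal (u x) * ennreal (k x) \<partial>lebesgue)"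
      by (rule nn_integral_density) auto
    also have "\<dots> = (\<integral>\<^sup>+x. ennreal (?h x) \<partial>lebesgue)"
    proof (rule nn_integral_cong_AE, use pos(1) in eventually_elim)
      case (elim x)
      then have "u x * u x powr (p / q - 1) = u x powr (p / q)" by (simp add: powr_diff)
      then have "u x * k x = ?h x" unfolding k_def pr' by (simp add: mult_ac)
      then show ?case using elim k0[of x] by (simp add: ennreal_mult[symmetric])
    qed
    finally have kh: "(\<integral>\<^sup>+x. ennreal (k x) \<partial>?M) = (\<integral>\<^sup>+x. ennreal (?h x) \<partial>lebesgue)" .
    show "epowr (\<integral>\<^sup>+x\<in>?E. ennreal (u x * v x powr s) \<partial>lebesgue) (1 / q)
      \<le> ennreal (C2 powr (1 / q)) * epowr (\<integral>\<^sup>+x. ennreal (?h x) \<partial>lebesgue) (1 / p)"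
    proof (cases "\<integral>\<^sup>+x. ennreal (?h x) \<partial>lebesgue")
      case top
      then show ?thesis using C2 by (simp add: epowr_def ennreal_mult_top)
    next
      case (real H)
      then have H: "(\<integral>\<^sup>+x. ennreal (k x) \<partial>?M) = ennreal H" "0 \<le> H" using kh by auto
      define S where "S x = (SUP Q\<in>\<R>. indicator Q x * epowr ((\<integral>\<^sup>+y\<in>Q. ennreal (k y powr b) \<partial>?M) / emeasure ?M Q) (1 / b))" for x
      have S_bound: "(\<integral>\<^sup>+x. S x \<partial>?M) \<le> ennreal C3 * ennreal H"
      proof -
        have "(\<integral>\<^sup>+x. S x \<partial>?M) \<le> ennreal C3 * (\<integral>\<^sup>+x. ennreal ((k x powr b) powr (1 / b)) \<partial>?M)"
          unfolding S_def C3_def by (rule strong_type_maximal[OF \<R>(1,2) _ _ b1]) auto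
        also have "(\<integral>\<^sup>+x. ennreal ((k x powr b) powr (1 / b)) \<partial>?M) = ennreal H"
          using k0 E.b H(1) by (simp add: powr_powr)
        finally show ?thesis .
      qed
      have [measurable]: "S \<in> borel_measurable lebesgue"
        unfolding S_def using \<R>(1,2)
        by (intro borel_measurable_SUP) (auto intro!: borel_measurable_times_ennreal borel_measurable_indicator)
      have pointwise: "ennreal (v x powr s) \<le> ennreal (C1 * H powr (q / p - 1)) * S x"
        if x: "x \<in> ?E" and w: "ennreal (v x powr s) \<le> (SUP Q\<in>{Q \<in> cubes. x \<in> Q}. average Q (\<lambda>x. ennreal (v x powr s)))" for x
      proof -
        obtain Q where Q: "Q \<in> cubes" "x \<in> Q"
          "(SUP Q\<in>{Q \<in> cubes. x \<in> Q}. average Q (\<lambda>x. ennreal (v x powr s)))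
            \<le> ennreal (c powr q * H powr (q / p - 1)) * epowr ((\<integral>\<^sup>+y\<in>Q. ennreal (k y powr b) \<partial>?M) / emeasure ?M Q) (1 / b)"
          by (rule level_set_pointwise[OF exps doubling _ _ _ pos t A k_def H K \<eta> \<gamma> c_def x]) auto
        note w
        also note Q(3)
        also have "ennreal (c powr q * H powr (q / p - 1)) * epowr ((\<integral>\<^sup>+y\<in>Q. ennreal (k y powr b) \<partial>?M) / emeasure ?M Q) (1 / b)
            \<le> ennreal (c powr q * H powr (q / p - 1)) * (ennreal (D powr (1 / b)) * S x)"
          unfolding S_def using E.b by (intro mult_left_mono average_le_countable_sup[OF \<R>(3,2) Q(1,2)]) auto
        also have "\<dots> = ennreal (C1 * H powr (q / p - 1)) * S x" by (simp add: C1_def ennreal_mult mult_ac)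
        finally show ?thesis .
      qed
      have "AE x in lebesgue. ennreal (v x powr s) \<le> (SUP Q\<in>{Q \<in> cubes. x \<in> Q}. average Q (\<lambda>x. ennreal (v x powr s)))"
        by (rule AE_le_maximal) measurable
      then have "AE x in lebesgue. ennreal (u x * v x powr s) * indicator ?E x
          \<le> ennreal (C1 * H powr (q / p - 1)) * (ennreal (u x) * S x)"
      proof eventually_elim
        case (elim x)
        show ?case
        proof (cases "x \<in> ?E")
          case True
          have "ennreal (u x) * ennreal (v x powr s) \<le> ennreal (u x) * (ennreal (C1 * H powr (q / p - 1)) * S x)"
            by (rule mult_left_mono[OF pointwise[OF True elim]]) simp
          then show ?thesis using True by (simp add: ennreal_mult'' mult_ac)
        qed auto
      qed
      then have "(\<integral>\<^sup>+x\<in>?E. ennreal (u x * v x powr s) \<partial>lebesgue)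
          \<le> (\<integral>\<^sup>+x. ennreal (C1 * H powr (q / p - 1)) * (ennreal (u x) * S x) \<partial>lebesgue)"
        by (rule nn_integral_mono_AE)
      also have "\<dots> = ennreal (C1 * H powr (q / p - 1)) * (\<integral>\<^sup>+x. S x \<partial>?M)"
        by (subst nn_integral_density) (auto intro!: nn_integral_cmult)
      also have "\<dots> \<le> ennreal (C1 * H powr (q / p - 1)) * (ennreal C3 * ennreal H)"
        using S_bound by (rule mult_left_mono) simp
      also have "\<dots> = ennreal (C2 * (H powr (q / p - 1) * H))"
        using C1 C3 H(2) by (simp add: C2_def ennreal_mult[symmetric] mult_ac)
      also have "H powr (q / p - 1) * H = H powr (q / p)"
        using H(2) by (cases "H = 0") (auto simp: powr_diff)
      finally have "epowr (\<integral>\<^sup>+x\<in>?E. ennreal (u x * v x powr s) \<partial>lebesgue) (1 / q) \<le> epowr (ennreal (C2 * H powr (q / p))) (1 / q)"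
        using q by (intro epowr_mono) auto
      also have "\<dots> = ennreal (C2 powr (1 / q)) * ennreal (H powr (1 / p))"
        using C2 q by (subst epowr_ennreal) (auto simp: powr_mult powr_powr ennreal_mult)
      also have "ennreal (H powr (1 / p)) = epowr (\<integral>\<^sup>+x. ennreal (?h x) \<partial>lebesgue) (1 / p)"
        using H(2) real by (simp add: epowr_ennreal)
      finally show ?thesis .
    qed
  qed
qed

end
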